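(* Let $E$ be a compact, polynomially convex subset of $\mathbb{C}$ which is regular and such that $g_E$ is Hölder continuous with constant $A$ and exponent $\alpha\in(0,1]$. Then for each sufficiently large $n\in\mathbb{N}$ there exists a polynomial $P_n$ of degree $n+1$ such that (i) $\Gamma(E,\mathcal{K}(P_n))\le(3A+12)\,n^{-1}\log(n+1)$ if $\alpha\in[1/2,1]$; (ii) $\Gamma(E,\mathcal{K}(P_n))\le(3A+12)\,n^{-2\alpha}$ if $\alpha\in(0,1/2)$.
   Context: For compact $E\subset\mathbb{C}$, $\widehat E=\{z\in\mathbb{C}:|p(z)|\le\max_{w\in E}|p(w)|\text{ for every complex polynomial }p\}$; $E$ is polynomially convex if $E=\widehat E$. $E$ is regular if the Green function of $D_\infty=\mathbb{C}\setminus\widehat E$ with pole at infinity exists: a function $g_E$, harmonic and positive in $D_\infty$, with $g_E(z)\to0$ as $z\to\partial D_\infty$ and $g_E(z)-\log|z|$ tending to a finite number as $z\to\infty$. It is extended by $0$ on $\widehat E$ to a continuous function on $\mathbb{C}$. $g_E$ is Hölder continuous with constant $A>0$ and exponent $\alpha$ if for all $\delta>0$ and $z\in\mathbb{C}$, $\mathrm{dist}(z,E)<\delta$ implies $g_E(z)\le A\delta^\alpha$. For a complex polynomial $P$ of degree at least $2$, the filled-in Julia set is $\mathcal{K}(P)=\{z\in\mathbb{C}:(P^{\circ n}(z))_{n\ge1}\text{ is bounded}\}$, where $P^{\circ n}$ is the $n$-th iterate (it is compact, polynomially convex and regular). For compact regular $E,F$, $\Gamma(E,F)=\max(\sup_F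 g_E,\ \sup_E g_F)$. *)

theory Defs
  imports "HOL-Complex_Analysis.Complex_Analysis"
    "HOL-Computational_Algebra.Computational_Algebra"
begin

definition poly_hull :: "complex set \<Rightarrow> complex set" where
  "poly_hull E = {z. \<forall>p :: complex poly. norm (poly p z) \<le> (SUP w\<in>E. norm (poly p w))}"

definition polynomially_convex :: "complex set \<Rightarrow> bool" where
  "polynomially_convex E \<longleftrightarrow> poly_hull E = E"

definition D_infinity :: "complex set \<Rightarrow> complex set" where
  "D_infinity E = - poly_hull E"

text \<open>Classical harmonicity on an open set: \<open>u\<close> is twice continuously differentiable in the
  real sense and its Laplacian vanishes. The witnesses are the partial derivatives of \<open>u\<close> with
  respect to the real and the imaginary part of the argument.\<close>

definition harmonic_on :: "(complex \<Rightarrow> real) \<Rightarrow> complex set \<Rightarrow> bool" where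
  "harmonic_on u S \<longleftrightarrow> open S \<and>
     (\<exists>ux uy uxx uxy uyx uyy :: complex \<Rightarrow> real.
        (\<forall>z\<in>S. (u has_derivative (\<lambda>h. ux z * Re h + uy z * Im h)) (at z) \<and>
               (ux has_derivative (\<lambda>h. uxx z * Re h + uxy z * Im h)) (at z) \<and>
               (uy has_derivative (\<lambda>h. uyx z * Re h + uyy z * Im h)) (at z) \<and>
               uxx z + uyy z = 0) \<and>
        continuous_on S uxx \<and> continuous_on S uxy \<and>
        continuous_on S uyx \<and> continuous_on S uyy)"

text \<open>The last conjunct is the extension by zero to the hull, which makes the function unique as a
  total function.\<close>

definition is_green_function :: "complex set \<Rightarrow> (complex \<Rightarrow> real) \<Rightarrow> bool" where
  "is_green_function E g \<longleftrightarrow>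
     harmonic_on g (D_infinity E) \<and>
     (\<forall>z\<in>D_infinity E. g z > 0) \<and>
     (\<forall>\<zeta>\<in>frontier (D_infinity E). (g \<longlongrightarrow> 0) (at \<zeta> within D_infinity E)) \<and>
     (\<exists>c. ((\<lambda>z. g z - ln (norm z)) \<longlongrightarrow> c) at_infinity) \<and>
     (\<forall>z\<in>poly_hull E. g z = 0)"

definition regular :: "complex set \<Rightarrow> bool" where
  "regular E \<longleftrightarrow> (\<exists>g. is_green_function E g)"

definition green :: "complex set \<Rightarrow> complex \<Rightarrow> real" where
  "green E = (THE g. is_green_function E g)"

definition green_holder :: "complex set \<Rightarrow> real \<Rightarrow> real \<Rightarrow> bool" where
  "green_holder E A \<alpha> \<longleftrightarrow>
     A > 0 \<and> (\<forall>\<delta>>0. \<forall>z. infdist z E < \<delta> \<longrightarrow> green E z \<le> A * \<delta> powr \<alpha>)"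

text \<open>Only meant for polynomials of degree at least two.\<close>

definition filled_julia :: "complex poly \<Rightarrow> complex set" where
  "filled_julia P = {z. bounded ((\<lambda>n. (poly P ^^ n) z) ` {1..})}"

definition klimek_dist :: "complex set \<Rightarrow> complex set \<Rightarrow> real" where
  "klimek_dist E F = max (SUP z\<in>F. green E z) (SUP z\<in>E. green F z)"

end

theory Submission
  imports Defs "HOL-Real_Asymp.Real_Asymp"
begin

text \<open>
  Write \<open>g\<close> for the Green function of \<open>E\<close>, \<open>d = n + 1\<close> and \<open>K(P)\<close> for the filled-in Julia set.
  The polynomials are small multiples of Fekete polynomials, shifted so that a small disc around
  a point of \<open>E\<close> attracts all of \<open>E\<close>.

  Let \<open>F\<close> be the polynomial whose zeros are \<open>d\<close> Fekete points of \<open>E\<close>, and \<open>M\<close> its maximum modulus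
  on \<open>E\<close>. The Bernstein--Walsh inequality \<open>\<bar>F\<bar> \<le> M exp (d g)\<close> bounds \<open>F\<close> from above. Conversely,
  the Lagrange basis polynomials at Fekete points have modulus at most \<open>1\<close> on \<open>E\<close>, which makes
  their denominators large, and they sum to \<open>1\<close>; hence \<open>\<bar>F\<bar>\<close> is at least \<open>M \<delta> / (d D)\<close> at
  distance \<open>\<delta>\<close> from \<open>E\<close>, where \<open>D\<close> bounds the diameter (\<open>fekete_polynomial_exists\<close>). The maximum
  principle for \<open>d g - ln \<bar>F\<bar>\<close> spreads this bound outwards: beyond distance \<open>\<delta>\<close>, \<open>\<bar>F\<bar>\<close> agrees
  with \<open>M exp (d g)\<close> up to a factor \<open>d D exp (d s) / \<delta>\<close>, where \<open>s\<close> bounds \<open>g\<close> up to distance \<open>\<delta>\<close>.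
  Hoelder continuity allows \<open>\<delta> = d powr (- 1 / \<alpha>)\<close> with \<open>d s = A\<close>, so that the logarithm of this
  factor is \<open>(1 + 1 / \<alpha>) ln d + O(1)\<close>.

  Put \<open>P = z0 + \<kappa> F\<close> with \<open>z0 \<in> E\<close> and \<open>\<kappa> = \<delta> exp (- A) / M\<close>. Then \<open>P\<close> maps both \<open>E\<close> and the disc of
  radius \<open>\<delta>\<close> around \<open>z0\<close> into this disc, so \<open>E \<subseteq> K(P)\<close>, and the Green function of \<open>K(P)\<close> vanishes on \<open>E\<close>
  (\<open>contracting_fekete_polynomial\<close>). In the other direction, the lower bound for \<open>\<bar>F\<bar>\<close> gives
  \<open>g (P z) \<ge> d g z - T\<close> with \<open>T = (1 + 2 / \<alpha>) ln d + O(1)\<close>. Hence points with \<open>g z > T / n\<close> escape,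
  and \<open>g \<le> T / n\<close> on \<open>K(P)\<close> (\<open>polynomials_with_nearby_julia_sets\<close>). For \<open>\<alpha> \<ge> 1/2\<close> the leading
  coefficient \<open>1 + 2 / \<alpha>\<close> is at most \<open>5 < 12\<close>; for \<open>\<alpha> < 1/2\<close> the quantity \<open>ln n / n\<close> is
  \<open>o(n powr (- 2 \<alpha>))\<close>.

  That the Green function of \<open>K(P)\<close> vanishes on \<open>K(P)\<close> presupposes that it exists and is unique.
  Uniqueness is the maximum principle again; existence (\<open>filled_julia_has_green_function\<close>) is the
  classical limit of \<open>ln \<bar>P^k\<bar> / d^k\<close>, written as a uniformly convergent series. All uses of
  potential theory reduce to the weak maximum principle for functions with vanishing Laplacian.
\<close>

section \<open>Harmonic functions and the weak maximum principle\<close>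

lemma second_derivative_nonpos_at_local_max:
  fixes f f' :: "real \<Rightarrow> real"
  assumes "r > 0"
    and f': "\<And>t. \<bar>t\<bar> < r \<Longrightarrow> (f has_real_derivative f' t) (at t)"
    and l: "(f' has_real_derivative l) (at 0)"
    and max: "\<And>t. \<bar>t\<bar> < r \<Longrightarrow> f t \<le> f 0"
  shows "l \<le> 0"
proof (rule ccontr)
  assume "\<not> l \<le> 0"
  then obtain s where s: "s > 0" "\<And>h. 0 < h \<Longrightarrow> h < s \<Longrightarrow> f' 0 < f' (0 + h)"
    using DERIV_pos_inc_right[OF l] by force
  have "f' 0 = 0"
    by (rule DERIV_local_max[OF f', of 0 r]) (use assms in auto)
  define t where "t = min r s / 2"
  have t: "0 < t" "t < r" "t < s"
    using \<open>r > 0\<close> \<open>s > 0\<close> by (auto simp: t_def min_def)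
  obtain x where x: "0 < x" "x < t" "f t - f 0 = (t - 0) * f' x"
    using MVT2[of 0 t f f'] f' t by force
  then have "f t - f 0 > 0"
    using s(2)[of x] \<open>f' 0 = 0\<close> t by simp
  with max[of t] t show False by simp
qed

lemma harmonic_on_imp_continuous_on:
  assumes "harmonic_on u S"
  shows "continuous_on S u"
proof (intro continuous_at_imp_continuous_on ballI)
  fix z assume "z \<in> S"
  with assms show "isCont u z"
    unfolding harmonic_on_def using has_derivative_continuous by blast
qed

lemma harmonic_on_subset:
  assumes "harmonic_on u S" "T \<subseteq> S" "open T"
  shows "harmonic_on u T"
proof -
  obtain ux uy uxx uxy uyx uyy where u:
    "\<And>z. z \<in> S \<Longrightarrow> (u has_derivative (\<lambda>h. ux z * Re h + uy z * Im h)) (at z) \<and>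
      (ux has_derivative (\<lambda>h. uxx z * Re h + uxy z * Im h)) (at z) \<and>
      (uy has_derivative (\<lambda>h. uyx z * Re h + uyy z * Im h)) (at z) \<and> uxx z + uyy z = 0"
    "continuous_on S uxx" "continuous_on S uxy" "continuous_on S uyx" "continuous_on S uyy"
    using assms(1) unfolding harmonic_on_def by blast
  show ?thesis
    unfolding harmonic_on_def
    by (rule conjI[OF assms(3)], rule exI[of _ ux], rule exI[of _ uy], rule exI[of _ uxx],
        rule exI[of _ uxy], rule exI[of _ uyx], rule exI[of _ uyy])
      (intro conjI; use u assms(2) in \<open>blast intro: continuous_on_subset\<close>)
qed

lemma harmonic_on_linear_combination:
  assumes "harmonic_on u S" "harmonic_on v S"
  shows "harmonic_on (\<lambda>z. a * u z + b * v z + c) S"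
proof -
  obtain ux uy uxx uxy uyx uyy where u:
    "\<And>z. z \<in> S \<Longrightarrow> (u has_derivative (\<lambda>h. ux z * Re h + uy z * Im h)) (at z)"
    "\<And>z. z \<in> S \<Longrightarrow> (ux has_derivative (\<lambda>h. uxx z * Re h + uxy z * Im h)) (at z)"
    "\<And>z. z \<in> S \<Longrightarrow> (uy has_derivative (\<lambda>h. uyx z * Re h + uyy z * Im h)) (at z)"
    "\<And>z. z \<in> S \<Longrightarrow> uxx z + uyy z = 0"
    "continuous_on S uxx" "continuous_on S uxy" "continuous_on S uyx" "continuous_on S uyy"
    and "open S"
    using assms(1) unfolding harmonic_on_def by blast
  obtain vx vy vxx vxy vyx vyy where v:
    "\<And>z. z \<in> S \<Longrightarrow> (v has_derivative (\<lambda>h. vx z * Re h + vy z * Im h)) (at z)"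
    "\<And>z. z \<in> S \<Longrightarrow> (vx has_derivative (\<lambda>h. vxx z * Re h + vxy z * Im h)) (at z)"
    "\<And>z. z \<in> S \<Longrightarrow> (vy has_derivative (\<lambda>h. vyx z * Re h + vyy z * Im h)) (at z)"
    "\<And>z. z \<in> S \<Longrightarrow> vxx z + vyy z = 0"
    "continuous_on S vxx" "continuous_on S vxy" "continuous_on S vyx" "continuous_on S vyy"
    using assms(2) unfolding harmonic_on_def by blast
  have comb: "((\<lambda>z. a * p z + b * q z + e) has_derivative
      (\<lambda>h. (a * px + b * qx) * Re h + (a * py + b * qy) * Im h)) (at z)"
    if "(p has_derivative (\<lambda>h. px * Re h + py * Im h)) (at z)"
      "(q has_derivative (\<lambda>h. qx * Re h + qy * Im h)) (at z)"
    for p q :: "complex \<Rightarrow> real" and px py qx qy e z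
    by (rule has_derivative_eq_rhs, (rule derivative_intros that)+)
       (simp add: fun_eq_iff algebra_simps)
  show ?thesis
    unfolding harmonic_on_def
    apply (intro conjI \<open>open S\<close>)
    apply (rule exI[of _ "\<lambda>z. a * ux z + b * vx z + 0"], rule exI[of _ "\<lambda>z. a * uy z + b * vy z + 0"])
    apply (rule exI[of _ "\<lambda>z. a * uxx z + b * vxx z"], rule exI[of _ "\<lambda>z. a * uxy z + b * vxy z"],
        rule exI[of _ "\<lambda>z. a * uyx z + b * vyx z"], rule exI[of _ "\<lambda>z. a * uyy z + b * vyy z"])
    apply (intro conjI ballI continuous_intros u v)
       apply (use comb[OF u(1) v(1)] in simp)
      apply (rule comb[OF u(2) v(2)]; assumption)
     apply (rule comb[OF u(3) v(3)]; assumption)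
    subgoal for z using u(4)[of z] v(4)[of z]
      by (smt (verit) distrib_left mult_eq_0_iff)
    done
qed

text \<open>
  The hypothesis says that locally \<open>u\<close> has a complex gradient \<open>G\<close>, as the real part of a
  holomorphic function with derivative \<open>G\<close> does. The gradient is determined by \<open>u\<close>, so the local
  choices fit together; the partial derivatives are then read off from \<open>G\<close> and \<open>G'\<close>, and
  the Laplacian vanishes by the Cauchy--Riemann equations. Working with \<open>G\<close> avoids branches of
  the logarithm when \<open>u\<close> is \<open>ln \<bar>f\<bar>\<close>.
\<close>
lemma harmonic_onI:
  fixes u :: "complex \<Rightarrow> real"
  assumes "open S"
    and loc: "\<And>z. z \<in> S \<Longrightarrow> \<exists>N G. open N \<and> z \<in> N \<and> G holomorphic_on N \<and>
      (\<forall>w\<in>N. (u has_derivative (\<lambda>h. Re (G w * h))) (at w))"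
  shows "harmonic_on u S"
proof -
  define D where "D z = (SOME c. (u has_derivative (\<lambda>h. Re (c * h))) (at z))" for z
  have D_eq: "D z = c" if "(u has_derivative (\<lambda>h. Re (c * h))) (at z)" for z c
  proof -
    have "(u has_derivative (\<lambda>h. Re (D z * h))) (at z)"
      unfolding D_def by (rule someI[of _ c]) (rule that)
    then have "(\<lambda>h. Re (D z * h)) = (\<lambda>h. Re (c * h))"
      using that has_derivative_unique by blast
    then have "Re (D z * 1) = Re (c * 1)" "Re (D z * \<i>) = Re (c * \<i>)"
      by meson+
    then show ?thesis by (simp add: complex_eq_iff)
  qed
  have u: "(u has_derivative (\<lambda>h. Re (D z * h))) (at z)" if "z \<in> S" for z
    using loc[OF that] D_eq by metis
  have "D field_differentiable at z" if z: "z \<in> S" for z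
  proof -
    obtain N G where N: "open N" "z \<in> N" "G holomorphic_on N"
      "\<forall>w\<in>N. (u has_derivative (\<lambda>h. Re (G w * h))) (at w)"
      using loc[OF z] by blast
    have "G holomorphic_on N \<longleftrightarrow> D holomorphic_on N"
      by (intro holomorphic_cong refl) (metis D_eq N(4))
    with N show ?thesis
      using holomorphic_on_imp_differentiable_at by blast
  qed
  then have hol: "D holomorphic_on S"
    using \<open>open S\<close> by (simp add: holomorphic_on_open field_differentiable_def)
  have D': "(D has_derivative (\<lambda>h. deriv D z * h)) (at z)" if "z \<in> S" for z
    using holomorphic_derivI[OF hol \<open>open S\<close> that] by (simp add: has_field_derivative_def)
  have cont: "continuous_on S (deriv D)"
    using holomorphic_deriv[OF hol \<open>open S\<close>] by (rule holomorphic_on_imp_continuous_on)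
  show ?thesis
    unfolding harmonic_on_def
    apply (intro conjI \<open>open S\<close>)
    apply (rule exI[of _ "\<lambda>z. Re (D z)"], rule exI[of _ "\<lambda>z. - Im (D z)"])
    apply (rule exI[of _ "\<lambda>z. Re (deriv D z)"], rule exI[of _ "\<lambda>z. - Im (deriv D z)"],
        rule exI[of _ "\<lambda>z. - Im (deriv D z)"], rule exI[of _ "\<lambda>z. - Re (deriv D z)"])
    apply (intro conjI ballI continuous_intros cont)
       apply (rule has_derivative_eq_rhs, erule u, simp add: fun_eq_iff)
      apply (rule has_derivative_eq_rhs, rule has_derivative_Re, erule D', simp add: fun_eq_iff)
     apply (rule has_derivative_eq_rhs, rule has_derivative_minus, rule has_derivative_Im, erule D',
        simp add: fun_eq_iff algebra_simps)
    apply simp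
    done
qed

lemma has_derivative_ln_norm:
  fixes f :: "complex \<Rightarrow> complex"
  assumes "(f has_field_derivative f') (at z)" "f z \<noteq> 0"
  shows "((\<lambda>z. ln (norm (f z))) has_derivative (\<lambda>h. Re (f' / f z * h))) (at z)"
proof -
  have f: "(f has_derivative (\<lambda>h. f' * h)) (at z)"
    using assms(1) by (simp add: has_field_derivative_def)
  have "(norm has_derivative (\<lambda>h. h \<bullet> sgn (f z))) (at (f z))"
    using has_derivative_norm[OF assms(2)] by simp
  from has_derivative_compose[OF f this]
  have norm: "((\<lambda>z. norm (f z)) has_derivative (\<lambda>h. (f' * h) \<bullet> sgn (f z))) (at z)" .
  have "((\<lambda>z. ln (norm (f z))) has_derivative
      (\<lambda>h. inverse (norm (f z)) * ((f' * h) \<bullet> sgn (f z)))) (at z)"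
    using assms(2)
    by (auto intro!: derivative_eq_intros norm simp: divide_simps)
  moreover have "inverse (norm (f z)) * ((f' * h) \<bullet> sgn (f z)) = Re (f' / f z * h)" for h
  proof -
    have "f' / f z * h = (f' * h) * cnj (f z) / complex_of_real ((norm (f z))^2)"
      by (simp add: complex_div_cnj[of f' "f z"])
    then have "Re (f' / f z * h) = ((f' * h) \<bullet> f z) / (norm (f z))^2"
      by (simp add: inner_complex_def complex_mult_cnj Re_divide_of_real algebra_simps del: of_real_power)
    then show ?thesis
      by (simp add: sgn_div_norm power2_eq_square field_simps)
  qed
  ultimately show ?thesis by simp
qed

lemma harmonic_on_ln_norm:
  assumes "open S" "f holomorphic_on S" "\<And>z. z \<in> S \<Longrightarrow> f z \<noteq> 0"
  shows "harmonic_on (\<lambda>z. ln (norm (f z))) S"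
proof (rule harmonic_onI[OF \<open>open S\<close>])
  fix z assume "z \<in> S"
  moreover have "(\<lambda>w. deriv f w / f w) holomorphic_on S"
    using assms by (intro holomorphic_intros) auto
  moreover have "((\<lambda>z. ln (norm (f z))) has_derivative (\<lambda>h. Re (deriv f w / f w * h))) (at w)"
    if "w \<in> S" for w
    using has_derivative_ln_norm[OF holomorphic_derivI[OF assms(2,1) that] assms(3)[OF that]] .
  ultimately show "\<exists>N G. open N \<and> z \<in> N \<and> G holomorphic_on N \<and>
      (\<forall>w\<in>N. ((\<lambda>z. ln (norm (f z))) has_derivative (\<lambda>h. Re (G w * h))) (at w))"
    using \<open>open S\<close> by blast
qed

text \<open>
  If \<open>u\<close> were positive somewhere, its superlevel sets would be compact. Adding a small multiple of
  \<open>\<bar>z\<bar>\<^sup>2\<close> makes the Laplacian positive, which the second derivative test along the two coordinate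
  directions forbids at a maximum. The set \<open>S\<close> may be unbounded; infinity counts as a boundary
  point.
\<close>
lemma harmonic_on_maximum_principle:
  fixes u :: "complex \<Rightarrow> real"
  assumes harm: "harmonic_on u S"
    and bdry: "\<And>\<zeta> \<eta>. \<zeta> \<in> frontier S \<Longrightarrow> \<eta> > 0 \<Longrightarrow> eventually (\<lambda>z. u z < \<eta>) (at \<zeta> within S)"
    and inf: "\<And>\<eta>. \<eta> > 0 \<Longrightarrow> eventually (\<lambda>z. z \<in> S \<longrightarrow> u z < \<eta>) at_infinity"
    and z0: "z0 \<in> S"
  shows "u z0 \<le> 0"
proof (rule ccontr)
  assume "\<not> u z0 \<le> 0"
  \<comment> \<open>The perturbation below is at most \<open>\<eta>\<close> on the superlevel set \<open>T\<close>. As \<open>u z0 = 3 \<eta>\<close>, its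
    maximizer still satisfies \<open>u > \<eta>\<close> and is interior to \<open>T\<close>.\<close>
  define \<eta> where "\<eta> = u z0 / 3"
  have \<eta>: "\<eta> > 0" using \<open>\<not> u z0 \<le> 0\<close> by (simp add: \<eta>_def)
  obtain ux uy uxx uxy uyx uyy where u:
    "\<And>z. z \<in> S \<Longrightarrow> (u has_derivative (\<lambda>h. ux z * Re h + uy z * Im h)) (at z)"
    "\<And>z. z \<in> S \<Longrightarrow> (ux has_derivative (\<lambda>h. uxx z * Re h + uxy z * Im h)) (at z)"
    "\<And>z. z \<in> S \<Longrightarrow> (uy has_derivative (\<lambda>h. uyx z * Re h + uyy z * Im h)) (at z)"
    "\<And>z. z \<in> S \<Longrightarrow> uxx z + uyy z = 0"
    and "open S"
    using harm unfolding harmonic_on_def by blast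
  have cont: "continuous_on S u" using harm by (rule harmonic_on_imp_continuous_on)
  define T where "T = {z \<in> S. u z \<ge> \<eta>}"
  obtain B where B: "B > 0" "\<And>z. z \<in> T \<Longrightarrow> norm z \<le> B"
  proof -
    obtain b where "\<And>z. norm z \<ge> b \<Longrightarrow> z \<in> S \<longrightarrow> u z < \<eta>"
      using inf[OF \<eta>] by (auto simp: eventually_at_infinity)
    then have "norm z \<le> max 1 b" if "z \<in> T" for z
      using that unfolding T_def
      by (metis (mono_tags, lifting) linear linorder_not_less max.coboundedI2 mem_Collect_eq)
    then show ?thesis using that[of "max 1 b"] by simp
  qed
  have "closed T"
    unfolding closed_sequential_limits
  proof (intro allI impI, elim conjE)
    fix x l assume x: "\<forall>n. x n \<in> T" and l: "x \<longlonglongrightarrow> l"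
    have "l \<in> closure S"
      using x l by (auto simp: closure_sequential T_def)
    show "l \<in> T"
    proof (cases "l \<in> S")
      case True
      then have "(\<lambda>n. u (x n)) \<longlonglongrightarrow> u l"
        using cont \<open>open S\<close> l continuous_on_eq_continuous_at isCont_tendsto_compose by blast
      then have "u l \<ge> \<eta>"
        by (rule LIMSEQ_le_const) (use x in \<open>auto simp: T_def\<close>)
      then show ?thesis using True by (simp add: T_def)
    next
      case False
      then have "l \<in> frontier S"
        using \<open>l \<in> closure S\<close> \<open>open S\<close> by (simp add: frontier_def interior_open)
      moreover have "filterlim x (at l within S) sequentially"
      proof -
        have "\<forall>n. x n \<in> S \<and> x n \<noteq> l" using x False by (auto simp: T_def)
        then show ?thesis using l by (simp add: filterlim_at)
      qed
      ultimately have "eventually (\<lambda>n. u (x n) < \<eta>) sequentially"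
        using eventually_compose_filterlim[OF bdry[OF _ \<eta>]] by blast
      then obtain n where "u (x n) < \<eta>" by (auto simp: eventually_sequentially)
      moreover have "u (x n) \<ge> \<eta>" using x by (simp add: T_def)
      ultimately show ?thesis by simp
    qed
  qed
  moreover have "bounded T" using B by (auto simp: bounded_iff)
  ultimately have "compact T" by (simp add: compact_eq_bounded_closed)
  define \<epsilon> where "\<epsilon> = \<eta> / B^2"
  have \<epsilon>: "\<epsilon> > 0" using \<eta> B by (simp add: \<epsilon>_def)
  define w where "w = (\<lambda>z. u z + \<epsilon> * ((Re z)^2 + (Im z)^2))"
  have "z0 \<in> T" using z0 \<eta> by (simp add: T_def \<eta>_def)
  moreover have "continuous_on T w"
    unfolding w_def by (intro continuous_intros continuous_on_subset[OF cont]) (auto simp: T_def)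
  ultimately obtain z1 where z1: "z1 \<in> T" "\<And>z. z \<in> T \<Longrightarrow> w z \<le> w z1"
    using continuous_attains_sup[of T w] \<open>compact T\<close> by auto
  have "z1 \<in> S" using z1 by (simp add: T_def)
  have "u z1 > \<eta>"
  proof -
    have "w z1 \<ge> 3 * \<eta>"
    proof -
      have "3 * \<eta> = u z0" by (simp add: \<eta>_def)
      also have "\<dots> \<le> w z0" using \<epsilon> by (simp add: w_def)
      also have "\<dots> \<le> w z1" by (rule z1(2)[OF \<open>z0 \<in> T\<close>])
      finally show ?thesis .
    qed
    moreover have "\<epsilon> * ((Re z1)^2 + (Im z1)^2) \<le> \<epsilon> * B^2"
      using \<epsilon> power_mono[OF B(2)[OF z1(1)] norm_ge_zero, of 2] by (simp add: cmod_power2)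
    moreover have "\<epsilon> * B^2 = \<eta>" using B by (simp add: \<epsilon>_def)
    ultimately show ?thesis using \<eta> by (simp add: w_def)
  qed
  obtain r where r: "r > 0" "\<And>z. dist z z1 < r \<Longrightarrow> z \<in> T"
  proof -
    have "open {z \<in> S. u z > \<eta>}"
      using continuous_open_preimage[OF cont \<open>open S\<close>, of "{\<eta><..}"]
      by (simp add: vimage_def Int_def)
    moreover have "z1 \<in> {z \<in> S. u z > \<eta>}" using \<open>z1 \<in> S\<close> \<open>u z1 > \<eta>\<close> by simp
    ultimately obtain r where "r > 0" "\<forall>z. dist z z1 < r \<longrightarrow> z \<in> {z \<in> S. u z > \<eta>}"
      unfolding open_dist by blast
    then show ?thesis by (intro that[of r]) (auto simp: T_def less_imp_le)
  qed
  have line: "((\<lambda>t. z1 + of_real t * e) has_derivative (\<lambda>t. of_real t * e)) (at t)" for e t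
    by (auto intro!: derivative_eq_intros)
  have inT: "z1 + of_real t * e \<in> T" if "\<bar>t\<bar> < r" "norm e = 1" for t and e :: complex
    using that by (intro r) (simp add: dist_norm norm_mult)
  have wmax: "w (z1 + of_real t * e) \<le> w (z1 + of_real 0 * e)"
    if "\<bar>t\<bar> < r" "norm e = 1" for t and e :: complex
    using z1(2)[OF inT[OF that]] by simp
  have inS: "z1 + of_real t * e \<in> S" if "\<bar>t\<bar> < r" "norm e = 1" for t and e :: complex
    using inT[OF that] by (simp add: T_def)
  have comp: "((\<lambda>t. p (z1 + of_real t * e)) has_real_derivative a * Re e + b * Im e) (at t)"
    if "(p has_derivative (\<lambda>h. a * Re h + b * Im h)) (at (z1 + of_real t * e))"
    for p :: "complex \<Rightarrow> real" and a b e t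
    using has_derivative_compose[OF line that]
    by (rule has_derivative_imp_has_field_derivative) (simp add: algebra_simps)
  have "uxx z1 + 2 * \<epsilon> \<le> 0"
  proof (rule second_derivative_nonpos_at_local_max[OF \<open>r > 0\<close>])
    show "((\<lambda>t. w (z1 + of_real t * 1)) has_real_derivative
        ux (z1 + of_real t * 1) + 2 * \<epsilon> * (Re z1 + t)) (at t)" if "\<bar>t\<bar> < r" for t
      unfolding w_def using comp[OF u(1)[OF inS[OF that]], of 1]
      by (auto intro!: derivative_eq_intros simp: algebra_simps)
    show "((\<lambda>t. ux (z1 + of_real t * 1) + 2 * \<epsilon> * (Re z1 + t)) has_real_derivative
        uxx z1 + 2 * \<epsilon>) (at 0)"
      using comp[OF u(2)[OF inS[of 0]], of 1] \<open>r > 0\<close>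
      by (auto intro!: derivative_eq_intros simp: algebra_simps)
  qed (rule wmax; simp)
  moreover have "uyy z1 + 2 * \<epsilon> \<le> 0"
  proof (rule second_derivative_nonpos_at_local_max[OF \<open>r > 0\<close>])
    show "((\<lambda>t. w (z1 + of_real t * \<i>)) has_real_derivative
        uy (z1 + of_real t * \<i>) + 2 * \<epsilon> * (Im z1 + t)) (at t)" if "\<bar>t\<bar> < r" for t
      unfolding w_def using comp[OF u(1)[OF inS[OF that]], of \<i>]
      by (auto intro!: derivative_eq_intros simp: algebra_simps)
    show "((\<lambda>t. uy (z1 + of_real t * \<i>) + 2 * \<epsilon> * (Im z1 + t)) has_real_derivative
        uyy z1 + 2 * \<epsilon>) (at 0)"
      using comp[OF u(3)[OF inS[of 0]], of \<i>] \<open>r > 0\<close>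
      by (auto intro!: derivative_eq_intros simp: algebra_simps)
  qed (rule wmax; simp)
  ultimately show False using u(4)[OF \<open>z1 \<in> S\<close>] \<epsilon> by simp
qed

section \<open>Green functions and polynomial growth\<close>

lemma D_infinity_open: "is_green_function E g \<Longrightarrow> open (D_infinity E)"
  by (simp add: is_green_function_def harmonic_on_def)

lemma ln_norm_poly_at_infinity:
  fixes p :: "complex poly"
  assumes "p \<noteq> 0"
  shows "((\<lambda>z. ln (norm (poly p z)) - real (degree p) * ln (norm z)) \<longlongrightarrow> ln (norm (lead_coeff p)))
    at_infinity"
proof -
  have "((\<lambda>z. ln (norm (poly p z / z ^ degree p))) \<longlongrightarrow> ln (norm (lead_coeff p))) at_infinity"
    using assms by (intro tendsto_intros poly_divide_tendsto_aux) auto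
  moreover have "eventually (\<lambda>z. ln (norm (poly p z / z ^ degree p)) =
      ln (norm (poly p z)) - real (degree p) * ln (norm z)) at_infinity"
    using tendsto_imp_eventually_ne[OF poly_divide_tendsto_aux[of p], of 0] assms
    by (auto elim!: eventually_mono simp: norm_divide norm_power ln_div ln_realpow)
  ultimately show ?thesis
    by (rule Lim_transform_eventually)
qed

text \<open>
  Near infinity \<open>u\<close> behaves like \<open>m ln \<bar>z\<bar>\<close>, while \<open>t g\<close> behaves like \<open>t ln \<bar>z\<bar>\<close>. Taking \<open>t\<close> slightly
  larger than \<open>m\<close> in the maximum principle settles the behaviour at infinity, so the singularity
  there never has to be removed.
\<close>
lemma eventually_less_if_log_pole_dominates:
  fixes u g :: "complex \<Rightarrow> real"
  assumes u: "((\<lambda>z. u z - m * ln (norm z)) \<longlongrightarrow> a) at_infinity"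
    and g: "((\<lambda>z. g z - ln (norm z)) \<longlongrightarrow> c) at_infinity"
    and "m < t"
  shows "eventually (\<lambda>z. u z - t * g z < \<eta>) at_infinity"
proof -
  have "((\<lambda>z. (u z - m * ln (norm z)) - t * (g z - ln (norm z))) \<longlongrightarrow> a - t * c) at_infinity"
    by (intro tendsto_intros u g)
  then have "eventually (\<lambda>z. (u z - m * ln (norm z)) - t * (g z - ln (norm z)) < a - t * c + 1) at_infinity"
    by (rule order_tendstoD) simp
  moreover have "filterlim (\<lambda>z::complex. ln (norm z)) at_top at_infinity"
    by (rule filterlim_compose[OF ln_at_top filterlim_norm_at_top])
  then have "eventually (\<lambda>z::complex. ln (norm z) > (a - t * c + 1 - \<eta>) / (t - m)) at_infinity"
    by (simp add: filterlim_at_top_dense)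
  ultimately show ?thesis
  proof eventually_elim
    case (elim z)
    from elim(2) \<open>m < t\<close> have "a - t * c + 1 - \<eta> < ln (norm z) * (t - m)"
      by (simp add: pos_divide_less_eq)
    with elim(1) show ?case by (simp add: algebra_simps)
  qed
qed

text \<open>
  The maximum principle applies to \<open>g - (1 + \<epsilon>) g'\<close>, which tends to \<open>-\<infinity>\<close> at infinity.
\<close>
lemma green_function_le:
  assumes g: "is_green_function E g" and g': "is_green_function E g'"
    and z: "z \<in> D_infinity E"
  shows "g z \<le> g' z"
proof -
  obtain c c' where c: "((\<lambda>z. g z - ln (norm z)) \<longlongrightarrow> c) at_infinity"
    and c': "((\<lambda>z. g' z - ln (norm z)) \<longlongrightarrow> c') at_infinity"
    using g g' unfolding is_green_function_def by blast
  have g'_pos: "g' z > 0" using g' z by (simp add: is_green_function_def)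
  have "g z \<le> g' z + e" if "e > 0" for e
  proof -
    define \<epsilon> where "\<epsilon> = e / g' z"
    have "\<epsilon> > 0" using that g'_pos by (simp add: \<epsilon>_def)
    have "1 * g z + (- (1 + \<epsilon>)) * g' z + 0 \<le> 0"
    proof (rule harmonic_on_maximum_principle[OF _ _ _ z])
      show "harmonic_on (\<lambda>z. 1 * g z + (- (1 + \<epsilon>)) * g' z + 0) (D_infinity E)"
        using g g' by (intro harmonic_on_linear_combination) (auto simp: is_green_function_def)
    next
      fix \<zeta> and \<eta> :: real assume "\<zeta> \<in> frontier (D_infinity E)" and "\<eta> > 0"
      then have "((\<lambda>z. 1 * g z + (- (1 + \<epsilon>)) * g' z + 0) \<longlongrightarrow> 1 * 0 + (- (1 + \<epsilon>)) * 0 + 0)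
          (at \<zeta> within D_infinity E)"
        using g g' unfolding is_green_function_def by (intro tendsto_intros) blast+
      then show "eventually (\<lambda>z. 1 * g z + (- (1 + \<epsilon>)) * g' z + 0 < \<eta>) (at \<zeta> within D_infinity E)"
        using \<open>\<eta> > 0\<close> by (intro order_tendstoD(2)) auto
    next
      fix \<eta> :: real assume "\<eta> > 0"
      have "eventually (\<lambda>z. g z - (1 + \<epsilon>) * g' z < \<eta>) at_infinity"
        by (rule eventually_less_if_log_pole_dominates[OF _ c', of _ 1]) (use c \<open>\<epsilon> > 0\<close> in auto)
      then show "eventually (\<lambda>z. z \<in> D_infinity E \<longrightarrow> 1 * g z + (- (1 + \<epsilon>)) * g' z + 0 < \<eta>) at_infinity"
        by eventually_elim (simp add: algebra_simps)
    qed
    then show ?thesis using g'_pos by (simp add: \<epsilon>_def algebra_simps)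
  qed
  then show ?thesis by (rule field_le_epsilon)
qed

lemma green_eqI:
  assumes "is_green_function E g"
  shows "green E = g"
  unfolding green_def
proof (rule the_equality)
  show "is_green_function E g" by (rule assms)
next
  fix g' assume g': "is_green_function E g'"
  show "g' = g"
  proof
    fix z
    show "g' z = g z"
    proof (cases "z \<in> D_infinity E")
      case True
      then show ?thesis
        using green_function_le[OF g' assms] green_function_le[OF assms g'] by (simp add: antisym)
    next
      case False
      then show ?thesis
        using assms g' by (simp add: is_green_function_def D_infinity_def)
    qed
  qed
qed

lemma is_green_function_green: "regular E \<Longrightarrow> is_green_function E (green E)"
  unfolding regular_def using green_eqI by metis

lemma harmonic_on_ln_norm_poly:
  fixes p :: "complex poly"
  assumes "open S" "\<And>z. z \<in> S \<Longrightarrow> poly p z \<noteq> 0"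
  shows "harmonic_on (\<lambda>z. ln (norm (poly p z))) S"
  using assms by (intro harmonic_on_ln_norm holomorphic_intros) auto

text \<open>
  The maximum principle for \<open>ln \<bar>p\<bar> - (n + \<epsilon>) g - ln M\<close>, with \<open>n\<close> the degree of \<open>p\<close>. Zeros of
  \<open>p\<close> in the domain are excluded so that this function is harmonic there.
\<close>
theorem bernstein_walsh:
  fixes p :: "complex poly"
  assumes g: "is_green_function E g"
    and nz: "\<And>z. z \<in> D_infinity E \<Longrightarrow> poly p z \<noteq> 0"
    and bdry: "\<And>\<zeta>. \<zeta> \<in> frontier (D_infinity E) \<Longrightarrow> norm (poly p \<zeta>) \<le> M"
    and "M > 0" and z: "z \<in> D_infinity E"
  shows "norm (poly p z) \<le> M * exp (real (degree p) * g z)"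
proof -
  let ?n = "real (degree p)"
  have "p \<noteq> 0" using nz[OF z] by auto
  obtain c where c: "((\<lambda>z. g z - ln (norm z)) \<longlongrightarrow> c) at_infinity"
    using g unfolding is_green_function_def by blast
  have gpos: "g z > 0" if "z \<in> D_infinity E" for z
    using g that by (simp add: is_green_function_def)
  have "ln (norm (poly p z)) \<le> ln M + ?n * g z + e" if "e > 0" for e
  proof -
    define \<epsilon> where "\<epsilon> = e / g z"
    have "\<epsilon> > 0" using that gpos[OF z] by (simp add: \<epsilon>_def)
    let ?u = "\<lambda>z. 1 * ln (norm (poly p z)) + (- (?n + \<epsilon>)) * g z + (- ln M)"
    have "?u z \<le> 0"
    proof (rule harmonic_on_maximum_principle[OF _ _ _ z])
      show "harmonic_on ?u (D_infinity E)"
        using g nz D_infinity_open[OF g]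
        by (intro harmonic_on_linear_combination harmonic_on_ln_norm_poly)
          (auto simp: is_green_function_def)
    next
      fix \<zeta> and \<eta> :: real assume \<zeta>: "\<zeta> \<in> frontier (D_infinity E)" and "\<eta> > 0"
      have "norm (poly p \<zeta>) < M * exp \<eta>"
        using bdry[OF \<zeta>] \<open>M > 0\<close> \<open>\<eta> > 0\<close>
        by (smt (verit) exp_gt_one mult_less_cancel_left1)
      moreover have "((\<lambda>z. norm (poly p z)) \<longlongrightarrow> norm (poly p \<zeta>)) (at \<zeta> within D_infinity E)"
        by (intro tendsto_intros)
      ultimately have "eventually (\<lambda>z. norm (poly p z) < M * exp \<eta>) (at \<zeta> within D_infinity E)"
        by (simp add: order_tendstoD)
      moreover have "eventually (\<lambda>z. z \<in> D_infinity E) (at \<zeta> within D_infinity E)"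
        by (auto simp: eventually_at_filter)
      ultimately show "eventually (\<lambda>z. ?u z < \<eta>) (at \<zeta> within D_infinity E)"
      proof eventually_elim
        case (elim z)
        then have "ln (norm (poly p z)) < ln (M * exp \<eta>)"
          using nz[of z] \<open>M > 0\<close> by (subst ln_less_cancel_iff) auto
        also have "\<dots> = ln M + \<eta>" using \<open>M > 0\<close> by (simp add: ln_mult)
        finally show ?case
          using mult_pos_pos[of "?n + \<epsilon>" "g z"] gpos[of z] elim \<open>\<epsilon> > 0\<close> by (simp add: algebra_simps)
      qed
    next
      fix \<eta> :: real assume "\<eta> > 0"
      have "eventually (\<lambda>z. ln (norm (poly p z)) - (?n + \<epsilon>) * g z < \<eta> + ln M) at_infinity"
        by (rule eventually_less_if_log_pole_dominates[OF ln_norm_poly_at_infinity[OF \<open>p \<noteq> 0\<close>] c])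
          (use \<open>\<epsilon> > 0\<close> in auto)
      then show "eventually (\<lambda>z. z \<in> D_infinity E \<longrightarrow> ?u z < \<eta>) at_infinity"
        by eventually_elim (simp add: algebra_simps)
    qed
    then show ?thesis using gpos[OF z] by (simp add: \<epsilon>_def algebra_simps)
  qed
  then have "ln (norm (poly p z)) \<le> ln M + ?n * g z"
    by (rule field_le_epsilon)
  also have "\<dots> = ln (M * exp (?n * g z))" using \<open>M > 0\<close> by (simp add: ln_mult)
  finally show ?thesis using nz[OF z] \<open>M > 0\<close> by (subst (asm) ln_le_cancel_iff) auto
qed

text \<open>
  The same argument for \<open>- ln \<bar>p\<bar>\<close>: a lower bound for \<open>\<bar>p\<bar>\<close> on the frontier of \<open>S\<close> is
  carried into \<open>S\<close> with the full growth rate of the Green function.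
\<close>
lemma poly_lower_bound_by_green_function:
  fixes p :: "complex poly"
  assumes g: "is_green_function E g"
    and S: "open S" "S \<subseteq> D_infinity E" "frontier S \<subseteq> D_infinity E"
    and nz: "\<And>z. z \<in> D_infinity E \<Longrightarrow> poly p z \<noteq> 0"
    and bdry: "\<And>\<zeta>. \<zeta> \<in> frontier S \<Longrightarrow> g \<zeta> \<le> s \<and> m \<le> norm (poly p \<zeta>)"
    and "m > 0" and z: "z \<in> S"
  shows "m * exp (real (degree p) * (g z - s)) \<le> norm (poly p z)"
proof -
  let ?n = "real (degree p)"
  have zD: "z \<in> D_infinity E" using z S by blast
  have "p \<noteq> 0" using nz[OF zD] by auto
  obtain c where c: "((\<lambda>z. g z - ln (norm z)) \<longlongrightarrow> c) at_infinity"
    using g unfolding is_green_function_def by blast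
  have gpos: "g z > 0" if "z \<in> D_infinity E" for z
    using g that by (simp add: is_green_function_def)
  have harm: "harmonic_on g (D_infinity E)" using g by (simp add: is_green_function_def)
  have "ln m + ?n * (g z - s) \<le> ln (norm (poly p z)) + e" if "e > 0" for e
  proof -
    define \<epsilon> where "\<epsilon> = e / g z"
    have "\<epsilon> > 0" using that gpos[OF zD] by (simp add: \<epsilon>_def)
    let ?u = "\<lambda>z. (- 1) * ln (norm (poly p z)) + (?n - \<epsilon>) * g z + (ln m - ?n * s)"
    have harm_u: "harmonic_on ?u (D_infinity E)"
      using harm nz D_infinity_open[OF g]
      by (intro harmonic_on_linear_combination harmonic_on_ln_norm_poly) auto
    have "?u z \<le> 0"
    proof (rule harmonic_on_maximum_principle[OF _ _ _ z])
      show "harmonic_on ?u S"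
        using harm_u S harmonic_on_subset by blast
    next
      fix \<zeta> and \<eta> :: real assume \<zeta>: "\<zeta> \<in> frontier S" and "\<eta> > 0"
      then have "\<zeta> \<in> D_infinity E" using S by blast
      then have "isCont ?u \<zeta>"
        using harmonic_on_imp_continuous_on[OF harm_u] D_infinity_open[OF g]
        by (simp add: continuous_on_eq_continuous_at)
      then have "(?u \<longlongrightarrow> ?u \<zeta>) (at \<zeta> within S)"
        by (meson continuous_at_imp_continuous_at_within continuous_within)
      moreover have "?u \<zeta> < \<eta>"
      proof -
        have "ln m \<le> ln (norm (poly p \<zeta>))"
          using bdry[OF \<zeta>] \<open>m > 0\<close> by (subst ln_le_cancel_iff) auto
        moreover have "?n * g \<zeta> \<le> ?n * s"
          using bdry[OF \<zeta>] by (simp add: mult_left_mono)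
        moreover have "\<epsilon> * g \<zeta> > 0" using \<open>\<epsilon> > 0\<close> gpos[OF \<open>\<zeta> \<in> D_infinity E\<close>] by simp
        ultimately show ?thesis using \<open>\<eta> > 0\<close> by (simp add: algebra_simps)
      qed
      ultimately show "eventually (\<lambda>z. ?u z < \<eta>) (at \<zeta> within S)"
        by (rule order_tendstoD)
    next
      fix \<eta> :: real assume "\<eta> > 0"
      have "((\<lambda>z. - ln (norm (poly p z)) - (- ?n) * ln (norm z)) \<longlongrightarrow> - ln (norm (lead_coeff p))) at_infinity"
        using tendsto_minus[OF ln_norm_poly_at_infinity[OF \<open>p \<noteq> 0\<close>]] by (simp add: algebra_simps)
      then have "eventually (\<lambda>z. - ln (norm (poly p z)) - (- ?n + \<epsilon>) * g z < \<eta> - (ln m - ?n * s)) at_infinity"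
        by (rule eventually_less_if_log_pole_dominates[OF _ c]) (use \<open>\<epsilon> > 0\<close> in auto)
      then show "eventually (\<lambda>z. z \<in> S \<longrightarrow> ?u z < \<eta>) at_infinity"
        by eventually_elim (simp add: algebra_simps)
    qed
    then show ?thesis using gpos[OF zD] by (simp add: \<epsilon>_def algebra_simps)
  qed
  then have "ln m + ?n * (g z - s) \<le> ln (norm (poly p z))"
    by (rule field_le_epsilon)
  then have "ln (m * exp (?n * (g z - s))) \<le> ln (norm (poly p z))"
    using \<open>m > 0\<close> by (simp add: ln_mult)
  then show ?thesis using nz[OF zD] \<open>m > 0\<close> by (subst (asm) ln_le_cancel_iff) auto
qed

text \<open>
  If \<open>E\<close> were finite, the polynomial with zero set \<open>E\<close> would satisfy the hypotheses of the
  Bernstein--Walsh inequality for every \<open>M > 0\<close>. The argument covers the empty set, where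
  this polynomial is \<open>1\<close> and the boundary condition is void.
\<close>
lemma polynomially_convex_regular_imp_infinite:
  assumes "polynomially_convex E" "regular E"
  shows "infinite E"
proof
  assume "finite E"
  have g: "is_green_function E (green E)" using assms(2) by (rule is_green_function_green)
  have D: "D_infinity E = - E" using assms(1) by (simp add: D_infinity_def polynomially_convex_def)
  define p where "p = (\<Prod>e\<in>E. [:- e, 1:])"
  have p0: "poly p z = 0 \<longleftrightarrow> z \<in> E" for z
    using \<open>finite E\<close> by (auto simp: p_def poly_prod)
  obtain z where "z \<notin> E"
    using \<open>finite E\<close> by (metis ex_new_if_finite infinite_UNIV_char_0)
  let ?e = "exp (real (degree p) * green E z)"
  have "norm (poly p z) > 0" using p0 \<open>z \<notin> E\<close> by simp
  have "norm (poly p z) \<le> (norm (poly p z) / (2 * ?e)) * ?e"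
  proof (rule bernstein_walsh[OF g])
    show "norm (poly p \<zeta>) \<le> norm (poly p z) / (2 * ?e)" if "\<zeta> \<in> frontier (D_infinity E)" for \<zeta>
    proof -
      have "\<zeta> \<in> E"
        using that \<open>finite E\<close> finite_imp_closed[of E] by (auto simp: D frontier_def closure_closed interior_complement)
      then have "poly p \<zeta> = 0" using p0 by blast
      then show ?thesis by simp
    qed
  qed (use \<open>z \<notin> E\<close> p0 D in auto)
  then show False using \<open>norm (poly p z) > 0\<close> by simp
qed

section \<open>Fekete points\<close>

text \<open>
  Maximize the product of all mutual distances of \<open>d\<close> points over a power of \<open>E\<close>, which is compact.
  Moving a single point \<open>\<zeta> j\<close> to \<open>z\<close> changes only the factors that involve it, and each of those
  occurs twice because the product runs over ordered pairs; comparing with the maximum gives the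
  stated inequality between their products.
\<close>
lemma fekete_points_exist:
  fixes E :: "complex set"
  assumes "compact E" "infinite E"
  obtains \<zeta> :: "nat \<Rightarrow> complex" where "\<And>i. \<zeta> i \<in> E" "inj_on \<zeta> {..<d}"
    "\<And>j z. j < d \<Longrightarrow> z \<in> E \<Longrightarrow>
      (\<Prod>k\<in>{..<d}-{j}. norm (z - \<zeta> k)) \<le> (\<Prod>k\<in>{..<d}-{j}. norm (\<zeta> j - \<zeta> k))"
proof -
  define V where "V \<zeta> = (\<Prod>i<d. \<Prod>k\<in>{..<d}-{i}. norm (\<zeta> i - \<zeta> k))" for \<zeta> :: "nat \<Rightarrow> complex"
  define X where "X = (PiE UNIV (\<lambda>_. E) :: (nat \<Rightarrow> complex) set)"
  obtain f :: "nat \<Rightarrow> complex" where f: "inj f" "range f \<subseteq> E"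
    using infinite_countable_subset[OF \<open>infinite E\<close>] by blast
  have "compact X"
    using compactin_PiE[of "\<lambda>_. euclidean" UNIV "\<lambda>_. E"] \<open>compact E\<close>
    by (simp add: X_def euclidean_product_topology)
  moreover have "f \<in> X" using f by (auto simp: X_def)
  moreover have "continuous_on X V"
  proof -
    have coord: "continuous_on X (\<lambda>\<zeta>. \<zeta> i)" for i
      by (rule continuous_on_subset[OF continuous_on_product_coordinates]) simp
    show ?thesis unfolding V_def by (intro continuous_intros coord)
  qed
  ultimately obtain \<zeta> where \<zeta>: "\<zeta> \<in> X" and max: "\<And>\<xi>. \<xi> \<in> X \<Longrightarrow> V \<xi> \<le> V \<zeta>"
    using continuous_attains_sup[of X V] by auto
  have in_E: "\<zeta> i \<in> E" for i using \<zeta> by (auto simp: X_def)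
  have "V f > 0"
    unfolding V_def using f(1) by (intro prod_pos) (auto dest: injD)
  then have V_pos: "V \<zeta> > 0" using max[OF \<open>f \<in> X\<close>] by linarith
  have inj: "inj_on \<zeta> {..<d}"
  proof (rule inj_onI, rule ccontr)
    fix i k assume ik: "i \<in> {..<d}" "k \<in> {..<d}" "\<zeta> i = \<zeta> k" "i \<noteq> k"
    then have "(\<Prod>k\<in>{..<d}-{i}. norm (\<zeta> i - \<zeta> k)) = 0"
      by (intro prod_zero) auto
    then have "V \<zeta> = 0"
      unfolding V_def using ik by (intro prod_zero) auto
    with V_pos show False by simp
  qed
  have fekete: "(\<Prod>k\<in>{..<d}-{j}. norm (z - \<zeta> k)) \<le> (\<Prod>k\<in>{..<d}-{j}. norm (\<zeta> j - \<zeta> k))"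
    if j: "j < d" and z: "z \<in> E" for j z
  proof -
    define R where "R = (\<Prod>i\<in>{..<d}-{j}. \<Prod>k\<in>{..<d}-{i}-{j}. norm (\<zeta> i - \<zeta> k))"
    have split: "V (\<zeta>(j := x)) = (\<Prod>k\<in>{..<d}-{j}. norm (x - \<zeta> k))^2 * R" for x
    proof -
      let ?\<xi> = "\<zeta>(j := x)"
      have "V ?\<xi> = (\<Prod>k\<in>{..<d}-{j}. norm (x - \<zeta> k)) *
          (\<Prod>i\<in>{..<d}-{j}. \<Prod>k\<in>{..<d}-{i}. norm (?\<xi> i - ?\<xi> k))"
        unfolding V_def using j by (subst prod.remove[of _ j]) (auto intro!: prod.cong)
      also have "(\<Prod>i\<in>{..<d}-{j}. \<Prod>k\<in>{..<d}-{i}. norm (?\<xi> i - ?\<xi> k)) =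
          (\<Prod>i\<in>{..<d}-{j}. norm (x - \<zeta> i) * (\<Prod>k\<in>{..<d}-{i}-{j}. norm (\<zeta> i - \<zeta> k)))"
      proof (rule prod.cong[OF refl])
        fix i assume i: "i \<in> {..<d} - {j}"
        then show "(\<Prod>k\<in>{..<d}-{i}. norm (?\<xi> i - ?\<xi> k)) =
            norm (x - \<zeta> i) * (\<Prod>k\<in>{..<d}-{i}-{j}. norm (\<zeta> i - \<zeta> k))"
          using j by (subst prod.remove[of _ j]) (auto intro!: prod.cong simp: norm_minus_commute)
      qed
      finally show ?thesis unfolding R_def power2_eq_square prod.distrib mult.assoc .
    qed
    have "R \<ge> 0" by (simp add: R_def prod_nonneg)
    moreover have "R \<noteq> 0" using V_pos split[of "\<zeta> j"] by auto
    ultimately have "R > 0" by simp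
    have "\<zeta>(j := z) \<in> X" using z in_E by (auto simp: X_def)
    then have "V (\<zeta>(j := z)) \<le> V (\<zeta>(j := \<zeta> j))" using max by simp
    then have "(\<Prod>k\<in>{..<d}-{j}. norm (z - \<zeta> k))^2 \<le> (\<Prod>k\<in>{..<d}-{j}. norm (\<zeta> j - \<zeta> k))^2"
      unfolding split using \<open>R > 0\<close> by simp
    then show ?thesis by (rule power2_le_imp_le) (simp add: prod_nonneg)
  qed
  show ?thesis by (rule that[OF in_E inj fekete])
qed

lemma sum_lagrange_basis_eq_1:
  fixes \<zeta> :: "nat \<Rightarrow> complex"
  assumes inj: "inj_on \<zeta> {..<d}" and "d > 0"
  shows "(\<Sum>j<d. \<Prod>k\<in>{..<d}-{j}. (z - \<zeta> k) / (\<zeta> j - \<zeta> k)) = 1"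
proof -
  define L where "L j = (\<Prod>k\<in>{..<d}-{j}. smult (1 / (\<zeta> j - \<zeta> k)) [:- \<zeta> k, 1:])" for j
  have L: "poly (L j) x = (\<Prod>k\<in>{..<d}-{j}. (x - \<zeta> k) / (\<zeta> j - \<zeta> k))" for j x
    by (simp add: L_def poly_prod diff_divide_distrib)
  have "(\<Sum>j<d. L j) = 1"
  proof (rule poly_eqI_degree)
    fix x assume "x \<in> \<zeta> ` {..<d}"
    then obtain i where i: "i < d" "x = \<zeta> i" by blast
    have "poly (L j) x = (if j = i then 1 else 0)" if "j < d" for j
    proof (cases "j = i")
      case True
      then show ?thesis
        unfolding L i using inj i by (auto intro!: prod.neutral simp: inj_on_eq_iff)
    next
      case False
      then show ?thesis unfolding L i using i by (auto intro!: prod_zero)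
    qed
    then show "poly (\<Sum>j<d. L j) x = poly 1 x" using i by (simp add: poly_sum)
  next
    have "degree (L j) \<le> d - 1" if "j < d" for j
    proof -
      have "degree (L j) \<le> (\<Sum>k\<in>{..<d}-{j}. 1)"
        unfolding L_def by (intro order_trans[OF degree_prod_sum_le] sum_mono) auto
      then show ?thesis using that by simp
    qed
    then have "degree (\<Sum>j<d. L j) \<le> d - 1" by (intro degree_sum_le) auto
    then show "degree (\<Sum>j<d. L j) < card (\<zeta> ` {..<d})"
      using card_image[OF inj] \<open>d > 0\<close> by simp
    show "degree (1 :: complex poly) < card (\<zeta> ` {..<d})"
      using card_image[OF inj] \<open>d > 0\<close> by simp
  qed
  then have "poly (\<Sum>j<d. L j) z = 1" by simp
  then show ?thesis by (simp add: poly_sum L)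
qed

text \<open>
  For Fekete points \<open>\<zeta> j\<close> and \<open>w \<in> E\<close> one has \<open>\<bar>F w\<bar> \<le> D W\<close>, where \<open>W\<close> is the product of the distances
  from \<open>\<zeta> j\<close> to the other points. As the \<open>j\<close>-th Lagrange basis polynomial at \<open>z\<close> has modulus
  \<open>\<bar>F z\<bar> / (\<bar>z - \<zeta> j\<bar> W)\<close>, it is at most \<open>D \<bar>F z\<bar> / (infdist z E \<bar>F w\<bar>)\<close>; summing over the
  \<open>d\<close> indices, whose basis polynomials add up to \<open>1\<close>, gives the bound.
\<close>
lemma fekete_polynomial_exists:
  fixes E :: "complex set"
  assumes "compact E" "infinite E" "d > 0"
    and D: "\<And>x y. x \<in> E \<Longrightarrow> y \<in> E \<Longrightarrow> dist x y \<le> D"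
  obtains F :: "complex poly" where "degree F = d" "\<And>z. poly F z = 0 \<Longrightarrow> z \<in> E"
    "\<And>w z. w \<in> E \<Longrightarrow> infdist z E * norm (poly F w) \<le> real d * D * norm (poly F z)"
proof -
  obtain \<zeta> :: "nat \<Rightarrow> complex" where \<zeta>: "\<And>i. \<zeta> i \<in> E" "inj_on \<zeta> {..<d}"
    and fekete: "\<And>j z. j < d \<Longrightarrow> z \<in> E \<Longrightarrow>
      (\<Prod>k\<in>{..<d}-{j}. norm (z - \<zeta> k)) \<le> (\<Prod>k\<in>{..<d}-{j}. norm (\<zeta> j - \<zeta> k))"
    using fekete_points_exist[OF assms(1,2)] by blast
  define F where "F = (\<Prod>k<d. [:- \<zeta> k, 1:])"
  have F: "norm (poly F z) = norm (z - \<zeta> j) * (\<Prod>k\<in>{..<d}-{j}. norm (z - \<zeta> k))" if "j < d" for j z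
    using prod.remove[of "{..<d}" j "\<lambda>k. norm (z - \<zeta> k)"] that
    by (simp add: F_def poly_prod prod_norm)
  have "infdist z E * norm (poly F w) \<le> real d * D * norm (poly F z)" if "w \<in> E" for w z
  proof -
    let ?c = "infdist z E * norm (poly F w)"
    have "?c * norm (\<Prod>k\<in>{..<d}-{j}. (z - \<zeta> k) / (\<zeta> j - \<zeta> k)) \<le> D * norm (poly F z)"
      if j: "j < d" for j
    proof -
      let ?W = "\<Prod>k\<in>{..<d}-{j}. norm (\<zeta> j - \<zeta> k)"
      let ?Q = "\<Prod>k\<in>{..<d}-{j}. norm (z - \<zeta> k)"
      have W: "?W > 0" using \<zeta>(2) j by (auto intro!: prod_pos dest: inj_onD)
      have "norm (poly F w) \<le> D * ?W"
        unfolding F[OF j] using D[OF \<open>w \<in> E\<close> \<zeta>(1)[of j]] fekete[OF j \<open>w \<in> E\<close>]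
        by (intro mult_mono) (auto simp: dist_norm prod_nonneg intro: order_trans[OF norm_ge_zero])
      then have "?c \<le> norm (z - \<zeta> j) * (D * ?W)"
        using infdist_le[OF \<zeta>(1)[of j], of z]
        by (intro mult_mono) (auto simp: dist_norm infdist_nonneg)
      then have "?c * (?Q / ?W) \<le> norm (z - \<zeta> j) * (D * ?W) * (?Q / ?W)"
        using W by (intro mult_right_mono) (auto simp: prod_nonneg)
      also have "\<dots> = D * norm (poly F z)"
      proof -
        have "x * (D * V) * (Q / V) = D * (x * Q)" if "V > 0" for x V Q :: real
          using that by simp
        from this[OF W] show ?thesis unfolding F[OF j] .
      qed
      finally show ?thesis by (simp add: prod_norm [symmetric] norm_divide prod_dividef)
    qed
    then have "(\<Sum>j<d. ?c * norm (\<Prod>k\<in>{..<d}-{j}. (z - \<zeta> k) / (\<zeta> j - \<zeta> k))) \<le>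
        (\<Sum>j<d. D * norm (poly F z))"
      by (intro sum_mono) auto
    moreover have "?c * 1 \<le> ?c * (\<Sum>j<d. norm (\<Prod>k\<in>{..<d}-{j}. (z - \<zeta> k) / (\<zeta> j - \<zeta> k)))"
      using sum_lagrange_basis_eq_1[OF \<zeta>(2) \<open>d > 0\<close>, of z]
        norm_sum[of "\<lambda>j. \<Prod>k\<in>{..<d}-{j}. (z - \<zeta> k) / (\<zeta> j - \<zeta> k)" "{..<d}"]
      by (intro mult_left_mono) (auto simp: infdist_nonneg)
    ultimately show ?thesis by (simp add: sum_distrib_left)
  qed
  moreover have "degree F = d"
    unfolding F_def by (subst degree_prod_sum_eq) auto
  moreover have "z \<in> E" if "poly F z = 0" for z
    using that \<zeta>(1) by (auto simp: F_def poly_prod)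
  ultimately show ?thesis using that by blast
qed

section \<open>The Green function of a filled-in Julia set\<close>

text \<open>
  The logarithm of the factor by which \<open>P\<close> deviates from its leading term. Near infinity the
  quotient is close to \<open>1\<close>, so the principal branch is holomorphic there.
\<close>
definition infinity_log :: "complex poly \<Rightarrow> complex \<Rightarrow> complex" where
  "infinity_log P w = Ln (poly P w / (lead_coeff P * w ^ degree P))"

text \<open>
  Outside the disc of radius \<open>R\<close> the map \<open>P\<close> is dominated by its leading term. The last condition
  makes the Green function positive there: the correction terms sum to at most
  \<open>1 / (degree P - 1) \<le> 1\<close>.
\<close>
locale escape_radius =
  fixes P :: "complex poly" and R :: real
  assumes degree: "degree P \<ge> 2" and R_ge_1: "R \<ge> 1"
    and slit: "\<And>w. R \<le> norm w \<Longrightarrow> poly P w / (lead_coeff P * w ^ degree P) \<notin> \<real>\<^sub>\<le>\<^sub>0"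
    and log_le_1: "\<And>w. R \<le> norm w \<Longrightarrow> norm (infinity_log P w) \<le> 1"
    and doubling: "\<And>w. R \<le> norm w \<Longrightarrow> 2 * norm w \<le> norm (poly P w)"
    and R_large: "ln R > 1 - ln (norm (lead_coeff P)) / (real (degree P) - 1)"

lemma tendsto_infinity_quotient:
  fixes P :: "complex poly"
  assumes "degree P > 0"
  shows "((\<lambda>w. poly P w / (lead_coeff P * w ^ degree P)) \<longlongrightarrow> 1) at_infinity"
proof -
  have "((\<lambda>w. (poly P w / w ^ degree P) / lead_coeff P) \<longlongrightarrow> lead_coeff P / lead_coeff P) at_infinity"
    by (rule tendsto_divide[OF poly_divide_tendsto_aux tendsto_const]) (use assms in auto)
  moreover have "P \<noteq> 0" using assms by auto
  ultimately show ?thesis by (simp add: field_simps)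
qed

lemma tendsto_infinity_log:
  fixes P :: "complex poly"
  assumes "degree P > 0"
  shows "(infinity_log P \<longlongrightarrow> 0) at_infinity"
  unfolding infinity_log_def[abs_def]
  using tendsto_Ln[OF tendsto_infinity_quotient[OF assms]] by simp

lemma escape_radius_exists:
  fixes P :: "complex poly"
  assumes "degree P \<ge> 2"
  obtains R where "escape_radius P R"
proof -
  let ?a = "lead_coeff P" and ?d = "degree P"
  let ?q = "\<lambda>w. poly P w / (?a * w ^ ?d)"
  have a: "?a \<noteq> 0" using assms by auto
  have q: "(?q \<longlongrightarrow> 1) at_infinity" using assms by (intro tendsto_infinity_quotient) auto
  have norm_large: "eventually (\<lambda>w::complex. norm w > c) at_infinity" for c
    using filterlim_norm_at_top[where 'a = complex] by (simp add: filterlim_at_top_dense)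
  have slit: "eventually (\<lambda>w. ?q w \<in> - \<real>\<^sub>\<le>\<^sub>0) at_infinity"
    by (rule topological_tendstoD[OF q]) auto
  have log: "eventually (\<lambda>w. norm (infinity_log P w) < 1) at_infinity"
    using tendstoD[OF tendsto_infinity_log[of P], of 1] assms by simp
  have half: "eventually (\<lambda>w. norm (?q w) > 1 / 2) at_infinity"
    using order_tendstoD(1)[OF tendsto_norm[OF q], of "1/2"] by simp
  have "eventually (\<lambda>w. ?q w \<notin> \<real>\<^sub>\<le>\<^sub>0 \<and> norm (infinity_log P w) \<le> 1 \<and> 2 * norm w \<le> norm (poly P w))
      at_infinity"
    using slit log half norm_large[of 1] norm_large[of "4 / norm ?a"]
  proof eventually_elim
    case (elim w)
    have w: "norm w > 1" "norm ?a * norm w > 4" "w \<noteq> 0"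
      using elim a by (auto simp: field_simps)
    have "norm w ^ 2 \<le> norm w ^ ?d" using w assms by (intro power_increasing) auto
    then have "norm ?a * norm w ^ 2 \<le> norm ?a * norm w ^ ?d"
      by (rule mult_left_mono) simp
    moreover have "4 * norm w \<le> (norm ?a * norm w) * norm w"
      using w by (intro mult_right_mono) auto
    ultimately have "4 * norm w \<le> norm ?a * norm w ^ ?d"
      by (simp add: power2_eq_square)
    moreover have "norm (poly P w) > 1 / 2 * (norm ?a * norm w ^ ?d)"
      using elim(3) a w by (simp add: norm_divide norm_mult norm_power field_simps)
    ultimately have "2 * norm w \<le> norm (poly P w)" by linarith
    then show ?case using elim by auto
  qed
  then obtain b where b: "\<And>w. b \<le> norm w \<Longrightarrow>
      ?q w \<notin> \<real>\<^sub>\<le>\<^sub>0 \<and> norm (infinity_log P w) \<le> 1 \<and> 2 * norm w \<le> norm (poly P w)"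
    by (auto simp: eventually_at_infinity)
  define c where "c = 1 - ln (norm ?a) / (real ?d - 1)"
  define R where "R = max (max 1 b) (exp (c + 1))"
  have "exp (c + 1) \<le> R" "R \<ge> 1" "R \<ge> b" by (auto simp: R_def)
  then have "ln R \<ge> c + 1" by (subst ln_ge_iff) auto
  then have "escape_radius P R"
    using assms b \<open>R \<ge> 1\<close> \<open>R \<ge> b\<close> by unfold_locales (auto simp: c_def)
  then show ?thesis by (rule that)
qed

context escape_radius
begin

abbreviation f :: "complex \<Rightarrow> complex" where "f \<equiv> poly P"
abbreviation d :: nat where "d \<equiv> degree P"
abbreviation K :: "complex set" where "K \<equiv> filled_julia P"

lemma lead_nz: "lead_coeff P \<noteq> 0" using degree by auto

lemma iterate_growth: "R \<le> norm z \<Longrightarrow> 2 ^ k * norm z \<le> norm ((f ^^ k) z)"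
proof (induction k)
  case (Suc k)
  have "R \<le> norm ((f ^^ k) z)"
    using Suc mult_right_mono[of 1 "2 ^ k" "norm z"] by simp
  from doubling[OF this] show ?case using Suc by simp
qed simp

lemma iterate_ge: "R \<le> norm z \<Longrightarrow> norm z \<le> norm ((f ^^ k) z)"
  using iterate_growth[of z k] mult_right_mono[of 1 "2 ^ k" "norm z"] by simp

lemma notin_filled_julia:
  assumes "R \<le> norm ((f ^^ m) z)"
  shows "z \<notin> K"
proof
  assume "z \<in> K"
  then obtain B where B: "\<And>k. k \<ge> 1 \<Longrightarrow> norm ((f ^^ k) z) \<le> B"
    by (auto simp: filled_julia_def bounded_iff)
  obtain k where k: "B < 2 ^ k" using real_arch_pow[of 2 B] by auto
  have "2 ^ Suc k * norm ((f ^^ m) z) \<le> norm ((f ^^ Suc k) ((f ^^ m) z))"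
    by (rule iterate_growth[OF assms])
  also have "\<dots> = norm ((f ^^ (Suc k + m)) z)" by (simp add: funpow_add)
  also have "\<dots> \<le> B" by (rule B) simp
  finally have "2 ^ Suc k * norm ((f ^^ m) z) \<le> B" .
  moreover have "2 ^ Suc k * 1 \<le> 2 ^ Suc k * norm ((f ^^ m) z)"
    using assms R_ge_1 by (intro mult_left_mono) auto
  moreover have "(2::real) ^ k \<le> 2 ^ Suc k" by simp
  ultimately show False using k by linarith
qed

lemma filled_julia_iff: "z \<in> K \<longleftrightarrow> (\<forall>k. norm ((f ^^ k) z) < R)"
proof
  assume "z \<in> K"
  then have "\<not> R \<le> norm ((f ^^ k) z)" for k using notin_filled_julia by blast
  then show "\<forall>k. norm ((f ^^ k) z) < R" by (simp add: not_le)
next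
  assume "\<forall>k. norm ((f ^^ k) z) < R"
  then show "z \<in> K"
    by (fastforce simp: filled_julia_def bounded_iff dest: less_imp_le)
qed

lemma notin_filled_julia_iff: "z \<notin> K \<longleftrightarrow> (\<exists>k. R < norm ((f ^^ k) z))"
proof
  assume "z \<notin> K"
  then obtain k where k: "R \<le> norm ((f ^^ k) z)" using filled_julia_iff[of z] by (meson not_le)
  then have "R < norm ((f ^^ Suc k) z)" using doubling[OF k] R_ge_1 by simp
  then show "\<exists>k. R < norm ((f ^^ k) z)" by (rule exI)
next
  assume "\<exists>k. R < norm ((f ^^ k) z)"
  then obtain k where "R < norm ((f ^^ k) z)" by blast
  then show "z \<notin> K" by (intro notin_filled_julia[of k]) simp
qed

text \<open>
  Lets the iterates serve as test polynomials for the hull.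
\<close>
lemma iterate_poly: "\<exists>p. poly p = f ^^ k"
proof (induction k)
  case 0
  show ?case by (rule exI[of _ "[:0, 1:]"]) (simp add: fun_eq_iff)
next
  case (Suc k)
  then obtain p where "poly p = f ^^ k" by blast
  then show ?case by (intro exI[of _ "pcompose P p"]) (simp add: fun_eq_iff poly_pcompose)
qed

lemma iterate_holomorphic: "(f ^^ k) holomorphic_on S"
proof -
  obtain p where p: "poly p = f ^^ k" using iterate_poly by blast
  show ?thesis unfolding p[symmetric] by (intro holomorphic_intros)
qed

lemma iterate_continuous: "continuous_on S (f ^^ k)"
  by (rule holomorphic_on_imp_continuous_on[OF iterate_holomorphic])

lemma open_compl: "open (- K)"
proof -
  have "- K = (\<Union>k. (\<lambda>z. norm ((f ^^ k) z)) -` {R<..})"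
    using notin_filled_julia_iff by auto
  moreover have "open ((\<lambda>z. norm ((f ^^ k) z)) -` {R<..})" for k
    by (intro open_vimage continuous_intros iterate_continuous)
  ultimately show ?thesis by auto
qed

text \<open>
  An escaping point is separated from the filled-in Julia set by a high iterate, which is a
  polynomial bounded by \<open>R\<close> on that set.
\<close>
lemma poly_hull_filled_julia:
  assumes "K \<noteq> {}"
  shows "poly_hull K = K"
proof (intro equalityI subsetI)
  fix z assume z: "z \<in> poly_hull K"
  show "z \<in> K"
  proof (rule ccontr)
    assume "z \<notin> K"
    then obtain k where k: "R < norm ((f ^^ k) z)" using notin_filled_julia_iff by blast
    obtain p where p: "poly p = f ^^ k" using iterate_poly by blast
    have "norm (poly p z) \<le> (SUP w\<in>K. norm (poly p w))" using z by (simp add: poly_hull_def)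
    also have "\<dots> \<le> R"
      using assms filled_julia_iff by (intro cSUP_least) (auto simp: p less_imp_le)
    finally show False using k p by simp
  qed
next
  fix z assume z: "z \<in> K"
  have "norm (poly p z) \<le> (SUP w\<in>K. norm (poly p w))" for p
  proof (rule cSUP_upper[OF z])
    have "compact ((\<lambda>w. norm (poly p w)) ` cball 0 R)"
      by (intro compact_continuous_image continuous_intros) auto
    then have "bdd_above ((\<lambda>w. norm (poly p w)) ` cball 0 R)"
      by (intro bounded_imp_bdd_above compact_imp_bounded)
    moreover have "K \<subseteq> cball 0 R"
      using filled_julia_iff[of w for w] by (force dest: spec[of _ 0])
    ultimately show "bdd_above ((\<lambda>w. norm (poly p w)) ` K)"
      by (meson bdd_above_mono image_mono)
  qed
  then show "z \<in> poly_hull K" by (simp add: poly_hull_def)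
qed

text \<open>
  The increments of \<open>ln (max R \<bar>P^k z\<bar>) / d^k\<close>, up to the factor \<open>d^(k+1)\<close>. Truncating the
  modulus from below by \<open>R\<close> makes them bounded on the whole plane.
\<close>
definition defect :: "complex \<Rightarrow> real" where
  "defect w = ln (max R (norm (f w))) - real d * ln (max R (norm w))"

text \<open>
  The limit of \<open>ln (max R \<bar>P^k z\<bar>) / d^k\<close>, as a telescoping series.
\<close>
definition green_candidate :: "complex \<Rightarrow> real" where
  "green_candidate z = ln (max R (norm z)) + (\<Sum>k. defect ((f ^^ k) z) * (1 / real d) ^ Suc k)"

lemma defect_outside:
  assumes "R \<le> norm w"
  shows "defect w = ln (norm (lead_coeff P)) + Re (infinity_log P w)"
proof -
  have w: "w \<noteq> 0" "norm w \<le> norm (f w)" "f w \<noteq> 0"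
    using assms R_ge_1 doubling[OF assms] by auto
  have "Re (infinity_log P w) = ln (norm (f w)) - (ln (norm (lead_coeff P)) + real d * ln (norm w))"
    using w lead_nz by (simp add: infinity_log_def norm_divide norm_mult norm_power ln_div ln_mult ln_realpow)
  then show ?thesis using assms w by (simp add: defect_def max_def)
qed

lemma defect_inside: "norm w < R \<Longrightarrow> norm (f w) < R \<Longrightarrow> defect w = (1 - real d) * ln R"
  by (simp add: defect_def algebra_simps)

lemma defect_bounded: obtains C where "C \<ge> 0" "\<And>w. \<bar>defect w\<bar> \<le> C"
proof -
  have "continuous_on (cball 0 R) defect"
    unfolding defect_def using R_ge_1 by (intro continuous_intros) auto
  then have "bounded (defect ` cball 0 R)"
    by (intro compact_imp_bounded compact_continuous_image) auto
  then obtain B where "\<forall>w\<in>cball 0 R. \<bar>defect w\<bar> \<le> B"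
    by (auto simp: bounded_iff)
  then have B: "\<And>w. norm w \<le> R \<Longrightarrow> \<bar>defect w\<bar> \<le> B" by simp
  have "\<bar>defect w\<bar> \<le> \<bar>ln (norm (lead_coeff P))\<bar> + 1" if "R \<le> norm w" for w
    using defect_outside[OF that] log_le_1[OF that] abs_Re_le_cmod[of "infinity_log P w"] by linarith
  then have "\<bar>defect w\<bar> \<le> max 0 (max B (\<bar>ln (norm (lead_coeff P))\<bar> + 1))" for w
    using B[of w] by (cases "norm w \<le> R") (auto simp: le_max_iff_disj)
  then show ?thesis by (rule that[rotated]) simp
qed

lemma inverse_degree_powers_sums: "(\<lambda>k. (1 / real d) ^ Suc k) sums (1 / (real d - 1))"
proof -
  have "(\<lambda>k. (1 / real d) * (1 / real d) ^ k) sums ((1 / real d) * (1 / (1 - 1 / real d)))"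
    using degree by (intro sums_mult geometric_sums) auto
  moreover have "(1 / real d) * (1 / (1 - 1 / real d)) = 1 / (real d - 1)"
    using degree by (simp add: field_simps)
  ultimately show ?thesis by simp
qed

text \<open>
  Continuity on the whole plane, including the boundary of the filled-in Julia set, is what the
  truncation by \<open>R\<close> buys: the partial sums converge uniformly everywhere.
\<close>
lemma continuous_green_candidate: "continuous_on UNIV green_candidate"
proof -
  obtain C where C: "C \<ge> 0" "\<And>w. \<bar>defect w\<bar> \<le> C" using defect_bounded by blast
  have "uniform_limit UNIV (\<lambda>n z. \<Sum>k<n. defect ((f ^^ k) z) * (1 / real d) ^ Suc k)
      (\<lambda>z. \<Sum>k. defect ((f ^^ k) z) * (1 / real d) ^ Suc k) sequentially"
  proof (rule Weierstrass_m_test)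
    show "norm (defect ((f ^^ k) z) * (1 / real d) ^ Suc k) \<le> C * (1 / real d) ^ Suc k" for k z
      using mult_right_mono[OF C(2)[of "(f ^^ k) z"], of "(1 / real d) ^ Suc k"]
      by (simp add: abs_mult power_abs)
    show "summable (\<lambda>k. C * (1 / real d) ^ Suc k)"
      using inverse_degree_powers_sums by (intro summable_mult) (rule sums_summable)
  qed
  moreover have "continuous_on UNIV defect"
    unfolding defect_def using R_ge_1 by (intro continuous_intros) auto
  then have "continuous_on UNIV (\<lambda>z. \<Sum>k<n. defect ((f ^^ k) z) * (1 / real d) ^ Suc k)" for n
    by (intro continuous_intros continuous_on_compose2[OF _ iterate_continuous]) auto
  ultimately have "continuous_on UNIV (\<lambda>z. \<Sum>k. defect ((f ^^ k) z) * (1 / real d) ^ Suc k)"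
    by (intro uniform_limit_theorem[OF always_eventually]) auto
  then show ?thesis
    unfolding green_candidate_def using R_ge_1 by (intro continuous_intros) auto
qed

lemma defect_summable: "summable (\<lambda>k. defect ((f ^^ k) z) * (1 / real d) ^ Suc k)"
proof -
  obtain C where C: "C \<ge> 0" "\<And>w. \<bar>defect w\<bar> \<le> C" using defect_bounded by blast
  show ?thesis
  proof (rule summable_comparison_test')
    show "summable (\<lambda>k. C * (1 / real d) ^ Suc k)"
      using inverse_degree_powers_sums by (intro summable_mult) (rule sums_summable)
    show "norm (defect ((f ^^ k) z) * (1 / real d) ^ Suc k) \<le> C * (1 / real d) ^ Suc k" for k
      using mult_right_mono[OF C(2)[of "(f ^^ k) z"], of "(1 / real d) ^ Suc k"]
      by (simp add: abs_mult power_abs)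
  qed
qed

lemma green_candidate_step: "green_candidate (f z) = real d * green_candidate z"
proof -
  let ?t = "\<lambda>k. defect ((f ^^ k) z) * (1 / real d) ^ Suc k"
  have d0: "real d \<noteq> 0" using degree by auto
  have "real d * suminf ?t = real d * (?t 0 + (\<Sum>k. ?t (Suc k)))"
    using suminf_split_head[OF defect_summable[of z]] by simp
  also have "\<dots> = defect z + (\<Sum>k. real d * ?t (Suc k))"
    using d0 suminf_mult[OF summable_Suc_iff[of ?t, THEN iffD2, OF defect_summable], of "real d"]
    by (simp add: distrib_left)
  also have "(\<lambda>k. real d * ?t (Suc k)) = (\<lambda>k. defect ((f ^^ k) (f z)) * (1 / real d) ^ Suc k)"
    using d0 by (auto simp: funpow_swap1)
  finally show ?thesis by (simp add: green_candidate_def defect_def algebra_simps)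
qed

lemma green_candidate_iterate: "green_candidate ((f ^^ k) z) = real d ^ k * green_candidate z"
  by (induction k) (simp_all add: green_candidate_step)

text \<open>
  Along a bounded orbit every truncated term equals \<open>(1 - d) ln R\<close>, and the geometric series cancels
  the leading \<open>ln R\<close>.
\<close>
lemma green_candidate_on_filled_julia:
  assumes "z \<in> K"
  shows "green_candidate z = 0"
proof -
  have "norm ((f ^^ k) z) < R" for k using assms filled_julia_iff by blast
  then have "defect ((f ^^ k) z) = (1 - real d) * ln R" for k
    using defect_inside[of "(f ^^ k) z"] by (metis funpow.simps(2) comp_apply)
  then have "(\<Sum>k. defect ((f ^^ k) z) * (1 / real d) ^ Suc k) = (1 - real d) * ln R * (1 / (real d - 1))"
    using sums_unique[OF sums_mult[OF inverse_degree_powers_sums, of "(1 - real d) * ln R"]] by simp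
  moreover have "norm z < R" using \<open>\<And>k. norm ((f ^^ k) z) < R\<close>[of 0] by simp
  ultimately have "green_candidate z = ln R + (1 - real d) * ln R * (1 / (real d - 1))"
    unfolding green_candidate_def by simp
  then show ?thesis using degree by (simp add: field_simps)
qed

text \<open>
  Up to an additive constant, \<open>ln z + bottcher_log z\<close> is the logarithm of the Boettcher coordinate
  that conjugates \<open>P\<close> to a power map near infinity; the real part of that logarithm is the Green
  function.
\<close>
definition bottcher_log :: "complex \<Rightarrow> complex" where
  "bottcher_log z = (\<Sum>k. infinity_log P ((f ^^ k) z) * of_real ((1 / real d) ^ Suc k))"

text \<open>
  The bound is used with \<open>e = 1\<close> for positivity of the Green function, and with arbitrarily small
  \<open>e\<close> for its behaviour at infinity.
\<close>
lemma bottcher_log_norm_le: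
  assumes "R \<le> norm z" and e: "\<And>w. norm z \<le> norm w \<Longrightarrow> norm (infinity_log P w) \<le> e"
  shows "summable (\<lambda>k. infinity_log P ((f ^^ k) z) * of_real ((1 / real d) ^ Suc k))"
    and "norm (bottcher_log z) \<le> e / (real d - 1)"
proof -
  let ?t = "\<lambda>k. infinity_log P ((f ^^ k) z) * complex_of_real ((1 / real d) ^ Suc k)"
  have bound: "norm (?t k) \<le> e * (1 / real d) ^ Suc k" for k
    unfolding norm_mult using e[OF iterate_ge[OF assms(1), of k]] order_trans[OF norm_ge_zero e[OF order_refl]]
    by (intro mult_mono) (auto simp: norm_power norm_divide)
  have sums: "(\<lambda>k. e * (1 / real d) ^ Suc k) sums (e * (1 / (real d - 1)))"
    by (intro sums_mult inverse_degree_powers_sums)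
  show "summable ?t"
    by (rule summable_comparison_test'[OF sums_summable[OF sums] bound])
  show "norm (bottcher_log z) \<le> e / (real d - 1)"
    unfolding bottcher_log_def
    using norm_suminf_le[of ?t, OF bound sums_summable[OF sums]] sums_unique[OF sums] by simp
qed

lemma log_le_1_beyond: "R \<le> norm z \<Longrightarrow> norm z \<le> norm w \<Longrightarrow> norm (infinity_log P w) \<le> 1"
  by (rule log_le_1) simp

lemma green_candidate_outside:
  assumes "R \<le> norm z"
  shows "green_candidate z = ln (norm z) + ln (norm (lead_coeff P)) / (real d - 1) + Re (bottcher_log z)"
proof -
  let ?t = "\<lambda>k. infinity_log P ((f ^^ k) z) * complex_of_real ((1 / real d) ^ Suc k)"
  have "summable ?t" by (rule bottcher_log_norm_le(1)[OF assms log_le_1_beyond[OF assms]])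
  then have "(\<lambda>k. Re (?t k)) sums Re (bottcher_log z)"
    unfolding bottcher_log_def by (intro sums_Re summable_sums)
  from sums_add[OF sums_mult[OF inverse_degree_powers_sums, of "ln (norm (lead_coeff P))"] this]
  have "(\<lambda>k. defect ((f ^^ k) z) * (1 / real d) ^ Suc k) sums
      (ln (norm (lead_coeff P)) * (1 / (real d - 1)) + Re (bottcher_log z))"
    using defect_outside[OF order_trans[OF assms iterate_ge[OF assms]]]
    by (simp add: distrib_right del: power_Suc of_real_power)
  from sums_unique[OF this] show ?thesis
    using assms by (simp add: green_candidate_def max_def)
qed

lemma green_candidate_pos:
  assumes "z \<notin> K"
  shows "green_candidate z > 0"
proof -
  have outside: "green_candidate w > 0" if w: "R \<le> norm w" for w
  proof -
    have "norm (bottcher_log w) \<le> 1 / (real d - 1)"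
      by (rule bottcher_log_norm_le(2)[OF w log_le_1_beyond[OF w]])
    also have "\<dots> \<le> 1" using degree by (simp add: field_simps)
    finally have "\<bar>Re (bottcher_log w)\<bar> \<le> 1" using abs_Re_le_cmod order_trans by blast
    moreover have "ln R \<le> ln (norm w)" using w R_ge_1 by (subst ln_le_cancel_iff) auto
    ultimately show ?thesis using green_candidate_outside[OF w] R_large by linarith
  qed
  obtain k where "R < norm ((f ^^ k) z)" using assms notin_filled_julia_iff by blast
  then have "real d ^ k * green_candidate z > 0"
    using outside[of "(f ^^ k) z"] by (simp add: green_candidate_iterate)
  then show ?thesis using degree by (simp add: zero_less_mult_iff)
qed

lemma infinity_log_holomorphic: "infinity_log P holomorphic_on {w. R < norm w}"
  unfolding infinity_log_def[abs_def]
  using slit R_ge_1 lead_nz by (intro holomorphic_intros) (auto dest: less_imp_le)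

lemma open_outside: "open {w::complex. R < norm w}"
  by (intro open_Collect_less continuous_intros)

lemma bottcher_log_holomorphic: "bottcher_log holomorphic_on {w. R < norm w}"
proof (rule holomorphic_uniform_sequence[OF open_outside])
  let ?U = "{w::complex. R < norm w}"
  let ?t = "\<lambda>k z. infinity_log P ((f ^^ k) z) * complex_of_real ((1 / real d) ^ Suc k)"
  have "(\<lambda>z. infinity_log P ((f ^^ k) z)) holomorphic_on ?U" for k
  proof -
    have "(f ^^ k) ` ?U \<subseteq> ?U"
    proof (intro subsetI, elim imageE)
      fix w z assume "w = (f ^^ k) z" "z \<in> ?U"
      then show "w \<in> ?U" using iterate_ge[of z k] by simp
    qed
    from holomorphic_on_compose_gen[OF iterate_holomorphic infinity_log_holomorphic this]
    show ?thesis by (simp add: o_def)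
  qed
  then show "(\<lambda>z. \<Sum>k<n. ?t k z) holomorphic_on ?U" for n
    by (intro holomorphic_intros)
  have lim: "uniform_limit ?U (\<lambda>n z. \<Sum>k<n. ?t k z) bottcher_log sequentially"
    unfolding bottcher_log_def[abs_def]
  proof (rule Weierstrass_m_test)
    show "norm (?t k z) \<le> (1 / real d) ^ Suc k" if "z \<in> ?U" for k z
    proof -
      have "norm (infinity_log P ((f ^^ k) z)) \<le> 1"
        using iterate_ge[of z k] that by (intro log_le_1) auto
      then have "norm (?t k z) \<le> 1 * (1 / real d) ^ Suc k"
        unfolding norm_mult by (intro mult_mono) (auto simp: norm_power norm_divide)
      then show ?thesis by simp
    qed
    show "summable (\<lambda>k. (1 / real d) ^ Suc k)" by (rule sums_summable[OF inverse_degree_powers_sums])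
  qed
  show "\<exists>e>0. cball z e \<subseteq> ?U \<and> uniform_limit (cball z e) (\<lambda>n z. \<Sum>k<n. ?t k z) bottcher_log sequentially"
    if "z \<in> ?U" for z
    using open_contains_cball[of ?U] open_outside that uniform_limit_on_subset[OF lim] by meson
qed

lemma green_candidate_has_derivative_outside:
  assumes "R < norm w"
  shows "(green_candidate has_derivative (\<lambda>h. Re ((1 / w + deriv bottcher_log w) * h))) (at w)"
proof -
  have "w \<noteq> 0" using assms R_ge_1 by auto
  then have "((\<lambda>z. ln (norm z)) has_derivative (\<lambda>h. Re (1 / w * h))) (at w)"
    using has_derivative_ln_norm[of "\<lambda>z. z" 1 w] by simp
  moreover have "(bottcher_log has_derivative (\<lambda>h. deriv bottcher_log w * h)) (at w)"
    using holomorphic_derivI[OF bottcher_log_holomorphic open_outside, of w] assms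
    by (simp add: has_field_derivative_def)
  then have "((\<lambda>z. Re (bottcher_log z)) has_derivative (\<lambda>h. Re (deriv bottcher_log w * h))) (at w)"
    by (rule has_derivative_Re)
  ultimately have "((\<lambda>z. ln (norm z) + ln (norm (lead_coeff P)) / (real d - 1) + Re (bottcher_log z))
      has_derivative (\<lambda>h. Re (1 / w * h) + 0 + Re (deriv bottcher_log w * h))) (at w)"
    by (intro has_derivative_add has_derivative_const)
  then have "((\<lambda>z. ln (norm z) + ln (norm (lead_coeff P)) / (real d - 1) + Re (bottcher_log z))
      has_derivative (\<lambda>h. Re ((1 / w + deriv bottcher_log w) * h))) (at w)"
    by (rule has_derivative_eq_rhs) (simp add: fun_eq_iff algebra_simps)
  then show ?thesis
    by (rule has_derivative_transform_within_open[OF _ open_outside])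
      (use assms in \<open>auto simp: green_candidate_outside\<close>)
qed

text \<open>
  Near an escaping point some iterate lies in the region \<open>\<bar>z\<bar> > R\<close>, where the gradient is explicit; the
  functional equation pulls it back.
\<close>
lemma harmonic_green_candidate: "harmonic_on green_candidate (- K)"
proof (rule harmonic_onI[OF open_compl])
  fix z assume "z \<in> - K"
  then obtain k where k: "R < norm ((f ^^ k) z)" using notin_filled_julia_iff by blast
  define N where "N = {w. R < norm ((f ^^ k) w)}"
  define H where "H w = 1 / w + deriv bottcher_log w" for w
  define G where "G w = H ((f ^^ k) w) * deriv (f ^^ k) w / of_nat d ^ k" for w
  have "open N"
    unfolding N_def by (intro open_Collect_less continuous_intros iterate_continuous)
  have "H holomorphic_on {w. R < norm w}"
    unfolding H_def using R_ge_1
    by (intro holomorphic_intros holomorphic_deriv bottcher_log_holomorphic open_outside) auto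
  then have "(\<lambda>w. H ((f ^^ k) w)) holomorphic_on N"
    using holomorphic_on_compose_gen[OF iterate_holomorphic, of H _ k N]
    by (force simp: o_def N_def)
  then have "G holomorphic_on N"
    unfolding G_def using degree \<open>open N\<close>
    by (intro holomorphic_intros holomorphic_deriv iterate_holomorphic) auto
  moreover have "(green_candidate has_derivative (\<lambda>h. Re (G w * h))) (at w)" if "w \<in> N" for w
  proof -
    have "((f ^^ k) has_derivative (\<lambda>h. deriv (f ^^ k) w * h)) (at w)"
      using holomorphic_derivI[OF iterate_holomorphic open_UNIV] by (simp add: has_field_derivative_def)
    from has_derivative_compose[OF this green_candidate_has_derivative_outside] that
    have "((\<lambda>w. green_candidate ((f ^^ k) w)) has_derivative
        (\<lambda>h. Re (H ((f ^^ k) w) * (deriv (f ^^ k) w * h)))) (at w)"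
      by (simp add: N_def H_def)
    then have "((\<lambda>w. green_candidate ((f ^^ k) w) / real d ^ k) has_derivative
        (\<lambda>h. Re (H ((f ^^ k) w) * (deriv (f ^^ k) w * h)) / real d ^ k)) (at w)"
      by (rule bounded_linear.has_derivative[OF bounded_linear_divide])
    moreover have "green_candidate ((f ^^ k) w) / real d ^ k = green_candidate w" for w
      using degree by (auto simp: green_candidate_iterate)
    moreover have "Re (H ((f ^^ k) w) * (deriv (f ^^ k) w * h)) / real d ^ k = Re (G w * h)" for h
    proof -
      have "G w * h = H ((f ^^ k) w) * (deriv (f ^^ k) w * h) / complex_of_real (real d ^ k)"
        by (simp add: G_def)
      then show ?thesis by (simp only: Re_divide_of_real)
    qed
    ultimately show ?thesis by simp
  qed
  ultimately show "\<exists>N G. open N \<and> z \<in> N \<and> G holomorphic_on N \<and>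
      (\<forall>w\<in>N. (green_candidate has_derivative (\<lambda>h. Re (G w * h))) (at w))"
    using \<open>open N\<close> k N_def by blast
qed

lemma bottcher_log_at_infinity: "(bottcher_log \<longlongrightarrow> 0) at_infinity"
proof (rule tendstoI)
  fix e :: real assume "e > 0"
  then have "eventually (\<lambda>w. norm (infinity_log P w) < e / 2) at_infinity"
    using tendstoD[OF tendsto_infinity_log[of P], of "e/2"] degree by simp
  then obtain b where b: "\<And>w. b \<le> norm w \<Longrightarrow> norm (infinity_log P w) < e / 2"
    by (auto simp: eventually_at_infinity)
  have "dist (bottcher_log z) 0 < e" if z: "max b R \<le> norm z" for z
  proof -
    have "norm (bottcher_log z) \<le> (e / 2) / (real d - 1)"
      using z b by (intro bottcher_log_norm_le(2)) (auto intro!: less_imp_le)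
    also have "\<dots> \<le> (e / 2) / 1"
      using \<open>e > 0\<close> degree by (intro divide_left_mono) auto
    finally show ?thesis using \<open>e > 0\<close> by simp
  qed
  then show "eventually (\<lambda>z. dist (bottcher_log z) 0 < e) at_infinity"
    unfolding eventually_at_infinity by blast
qed

lemma green_candidate_at_infinity:
  "((\<lambda>z. green_candidate z - ln (norm z)) \<longlongrightarrow> ln (norm (lead_coeff P)) / (real d - 1)) at_infinity"
proof -
  have "((\<lambda>z. ln (norm (lead_coeff P)) / (real d - 1) + Re (bottcher_log z)) \<longlongrightarrow>
      ln (norm (lead_coeff P)) / (real d - 1) + Re 0) at_infinity"
    by (intro tendsto_intros bottcher_log_at_infinity)
  moreover have "eventually (\<lambda>z. ln (norm (lead_coeff P)) / (real d - 1) + Re (bottcher_log z) =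
      green_candidate z - ln (norm z)) at_infinity"
    using green_candidate_outside by (auto simp: eventually_at_infinity intro!: exI[of _ R])
  ultimately show ?thesis by (auto intro: Lim_transform_eventually)
qed

lemma is_green_function_green_candidate:
  assumes "K \<noteq> {}"
  shows "is_green_function K green_candidate"
proof -
  have hull: "poly_hull K = K" by (rule poly_hull_filled_julia[OF assms])
  have "(green_candidate \<longlongrightarrow> 0) (at \<zeta> within - K)" if "\<zeta> \<in> frontier (- K)" for \<zeta>
  proof -
    have "\<zeta> \<in> K"
      using that open_compl by (auto simp: frontier_def interior_open)
    moreover have "isCont green_candidate \<zeta>"
      using continuous_green_candidate by (simp add: continuous_on_eq_continuous_at)
    then have "(green_candidate \<longlongrightarrow> green_candidate \<zeta>) (at \<zeta> within - K)"
      by (meson continuous_at_imp_continuous_at_within continuous_within)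
    ultimately show ?thesis using green_candidate_on_filled_julia by simp
  qed
  then show ?thesis
    unfolding is_green_function_def D_infinity_def hull
    using harmonic_green_candidate green_candidate_pos green_candidate_on_filled_julia
      green_candidate_at_infinity
    by auto
qed

end

theorem filled_julia_has_green_function:
  assumes "degree P \<ge> 2" "filled_julia P \<noteq> {}"
  obtains g where "is_green_function (filled_julia P) g" "\<And>z. z \<in> filled_julia P \<Longrightarrow> g z = 0"
proof -
  obtain R where "escape_radius P R" using escape_radius_exists[OF assms(1)] by blast
  then interpret escape_radius P R .
  show ?thesis
    using is_green_function_green_candidate[OF assms(2)] green_candidate_on_filled_julia
    by (rule that)
qed

section \<open>Approximation by filled-in Julia sets\<close>

text \<open>
  The definition speaks of distances strictly below \<open>\<delta>\<close>; let \<open>\<delta>\<close> decrease.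
\<close>
lemma green_holder_closed:
  assumes "green_holder E A \<alpha>" "\<delta> > 0" "infdist z E \<le> \<delta>"
  shows "green E z \<le> A * \<delta> powr \<alpha>"
proof (rule tendsto_lowerbound)
  show "((\<lambda>x. A * x powr \<alpha>) \<longlongrightarrow> A * \<delta> powr \<alpha>) (at_right \<delta>)"
    using \<open>\<delta> > 0\<close> by (intro tendsto_intros) auto
  show "eventually (\<lambda>x. green E z \<le> A * x powr \<alpha>) (at_right \<delta>)"
    using assms unfolding green_holder_def eventually_at_right_field
    by (intro exI[of _ "\<delta> + 1"]) auto
qed auto

lemma green_function_log_lower_bound:
  assumes "is_green_function E g"
  obtains R b where "R \<ge> 1" "b \<ge> 0" "\<And>z. R \<le> norm z \<Longrightarrow> ln (norm z) - b \<le> g z"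
proof -
  obtain c where "((\<lambda>z. g z - ln (norm z)) \<longlongrightarrow> c) at_infinity"
    using assms unfolding is_green_function_def by blast
  then have "eventually (\<lambda>z. g z - ln (norm z) > c - 1) at_infinity"
    by (rule order_tendstoD) simp
  then obtain r where r: "\<And>z. r \<le> norm z \<Longrightarrow> g z - ln (norm z) > c - 1"
    by (auto simp: eventually_at_infinity)
  have "ln (norm z) - \<bar>c - 1\<bar> \<le> g z" if "max 1 r \<le> norm z" for z
    using r[of z] that by simp
  then show ?thesis by (intro that[of "max 1 r" "\<bar>c - 1\<bar>"]) auto
qed

text \<open>
  Above the level \<open>\<tau>\<close> the excess \<open>g - \<tau>\<close> grows at least geometrically along the orbit, so the
  orbit cannot stay in a region where \<open>g\<close> is bounded.
\<close>
lemma filled_julia_sublevel: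
  fixes g :: "complex \<Rightarrow> real" and P :: "complex poly"
  assumes q: "q > 1"
    and bdd: "\<And>B. \<exists>C. \<forall>z. norm z \<le> B \<longrightarrow> g z \<le> C"
    and expand: "\<And>z. g z > \<tau> \<Longrightarrow> q * (g z - \<tau>) \<le> g (poly P z) - \<tau>"
    and z: "z \<in> filled_julia P"
  shows "g z \<le> \<tau>"
proof (rule ccontr)
  assume "\<not> g z \<le> \<tau>"
  then have gz: "g z > \<tau>" by simp
  have iter: "q ^ k * (g z - \<tau>) \<le> g ((poly P ^^ k) z) - \<tau>" for k
  proof (induction k)
    case (Suc k)
    have "0 < q ^ k * (g z - \<tau>)" using q gz by simp
    then have "g ((poly P ^^ k) z) > \<tau>" using Suc by linarith
    from expand[OF this] have "q * (g ((poly P ^^ k) z) - \<tau>) \<le> g ((poly P ^^ Suc k) z) - \<tau>" by simp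
    moreover have "q * (q ^ k * (g z - \<tau>)) \<le> q * (g ((poly P ^^ k) z) - \<tau>)"
      using Suc q by (intro mult_left_mono) auto
    ultimately show ?case by (simp add: mult.assoc)
  qed simp
  obtain B where B: "\<And>k. k \<ge> 1 \<Longrightarrow> norm ((poly P ^^ k) z) \<le> B"
    using z by (auto simp: filled_julia_def bounded_iff)
  obtain C where C: "\<And>w. norm w \<le> B \<Longrightarrow> g w \<le> C" using bdd by blast
  obtain k where k: "(C - \<tau>) / (g z - \<tau>) < q ^ k" using real_arch_pow[OF q] by blast
  have "(C - \<tau>) / (g z - \<tau>) < q ^ Suc k"
    using q by (intro less_le_trans[OF k] power_increasing) auto
  then have "C - \<tau> < q ^ Suc k * (g z - \<tau>)"
    using gz by (simp add: pos_divide_less_eq)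
  also have "\<dots> \<le> g ((poly P ^^ Suc k) z) - \<tau>" by (rule iter)
  finally show False using C[OF B[of "Suc k"]] by simp
qed

lemma forward_invariant_subset_filled_julia:
  assumes "bounded S" and inv: "\<And>z. z \<in> S \<Longrightarrow> poly P z \<in> S"
  shows "S \<subseteq> filled_julia P"
proof
  fix z assume "z \<in> S"
  then have "(poly P ^^ k) z \<in> S" for k
    by (induction k) (auto intro: inv)
  then have "(\<lambda>k. (poly P ^^ k) z) ` {1..} \<subseteq> S" by blast
  then show "z \<in> filled_julia P"
    unfolding filled_julia_def using \<open>bounded S\<close> bounded_subset by blast
qed

text \<open>
  The polynomial is \<open>P = z0 + \<kappa> F\<close> with a Fekete polynomial \<open>F\<close> and a point \<open>z0 \<in> E\<close>. The two
  conclusions are the upper and lower bounds for \<open>F\<close> from potential theory, rescaled so that \<open>P\<close>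
  contracts a neighbourhood of \<open>E\<close> into a disc around \<open>z0\<close>.
\<close>
lemma contracting_fekete_polynomial:
  fixes E :: "complex set" and g :: "complex \<Rightarrow> real"
  assumes "compact E" "infinite E" "polynomially_convex E" and g: "is_green_function E g"
    and "d > 0" "\<delta> > 0" "D > 0" and D: "\<And>x y. x \<in> E \<Longrightarrow> y \<in> E \<Longrightarrow> dist x y \<le> D"
    and near: "\<And>z. infdist z E \<le> \<delta> \<Longrightarrow> g z \<le> s"
  obtains P z0 where "degree P = d" "z0 \<in> E"
    "\<And>z. infdist z E \<le> \<delta> \<Longrightarrow> dist (poly P z) z0 \<le> \<delta>"
    "\<And>z. infdist z E > \<delta> \<Longrightarrow>
      \<delta>^2 / (real d * D) * exp (real d * (g z - 2 * s)) \<le> dist (poly P z) z0"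
proof -
  have D_inf: "D_infinity E = - E"
    using assms(3) by (simp add: D_infinity_def polynomially_convex_def)
  have "E \<noteq> {}" using \<open>infinite E\<close> by auto
  have closed: "closed E" using \<open>compact E\<close> by (rule compact_imp_closed)
  obtain F where F: "degree F = d" "\<And>z. poly F z = 0 \<Longrightarrow> z \<in> E"
    "\<And>w z. w \<in> E \<Longrightarrow> infdist z E * norm (poly F w) \<le> real d * D * norm (poly F z)"
    using fekete_polynomial_exists[OF \<open>compact E\<close> \<open>infinite E\<close> \<open>d > 0\<close> D] by blast
  have "F \<noteq> 0" using F(1) \<open>d > 0\<close> by auto
  obtain z0 where z0: "z0 \<in> E" using \<open>E \<noteq> {}\<close> by blast
  obtain w0 where w0: "w0 \<in> E" "\<And>w. w \<in> E \<Longrightarrow> norm (poly F w) \<le> norm (poly F w0)"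
  proof -
    have "continuous_on E (\<lambda>w. norm (poly F w))" by (intro continuous_intros)
    from continuous_attains_sup[OF \<open>compact E\<close> \<open>E \<noteq> {}\<close> this] show ?thesis using that by blast
  qed
  define M where "M = norm (poly F w0)"
  have M: "norm (poly F w) \<le> M" if "w \<in> E" for w using w0(2)[OF that] by (simp add: M_def)
  have "M > 0"
  proof -
    obtain w where "w \<in> E" "poly F w \<noteq> 0"
      using \<open>infinite E\<close> poly_roots_finite[OF \<open>F \<noteq> 0\<close>]
      by (metis (mono_tags, lifting) finite_subset mem_Collect_eq subsetI)
    then show ?thesis using M[of w] by (meson less_le_trans zero_less_norm_iff)
  qed
  have "s \<ge> 0"
    using near[of z0] z0 \<open>\<delta> > 0\<close> g assms(3)
    by (simp add: is_green_function_def polynomially_convex_def)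
  have nz: "poly F z \<noteq> 0" if "z \<in> D_infinity E" for z using F(2) that D_inf by auto

  have upper: "norm (poly F z) \<le> M * exp (real d * s)" if "infdist z E \<le> \<delta>" for z
  proof (cases "z \<in> E")
    case True
    have "M * 1 \<le> M * exp (real d * s)" using \<open>s \<ge> 0\<close> \<open>M > 0\<close> by (intro mult_left_mono) auto
    then show ?thesis using M[OF True] by simp
  next
    case False
    have "frontier (D_infinity E) \<subseteq> E"
      using closed by (auto simp: D_inf frontier_def interior_open open_Compl)
    with False have "norm (poly F z) \<le> M * exp (real (degree F) * g z)"
      by (intro bernstein_walsh[OF g nz M \<open>M > 0\<close>]) (auto simp: D_inf)
    also have "\<dots> \<le> M * exp (real d * s)"
      using near[OF that] \<open>M > 0\<close> F(1) by (simp add: mult_left_mono)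
    finally show ?thesis .
  qed

  define m where "m = \<delta> * M / (real d * D)"
  have "m > 0" using \<open>\<delta> > 0\<close> \<open>M > 0\<close> \<open>d > 0\<close> \<open>D > 0\<close> by (simp add: m_def)
  have lower: "m * exp (real d * (g z - s)) \<le> norm (poly F z)" if "infdist z E > \<delta>" for z
  proof -
    let ?S = "{z. infdist z E > \<delta>}"
    have S: "open ?S" by (intro open_Collect_less continuous_intros)
    have front: "infdist \<zeta> E = \<delta>" if "\<zeta> \<in> frontier ?S" for \<zeta>
    proof -
      have "closure ?S \<subseteq> {z. \<delta> \<le> infdist z E}"
        by (rule closure_minimal) (auto intro!: closed_Collect_le continuous_intros)
      then show ?thesis using that S by (force simp: frontier_def interior_open)
    qed
    have "m * exp (real (degree F) * (g z - s)) \<le> norm (poly F z)"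
    proof (rule poly_lower_bound_by_green_function[OF g S _ _ nz])
      show "?S \<subseteq> D_infinity E" using \<open>\<delta> > 0\<close> by (auto simp: D_inf)
      show "frontier ?S \<subseteq> D_infinity E" using front \<open>\<delta> > 0\<close> by (force simp: D_inf)
      show "g \<zeta> \<le> s \<and> m \<le> norm (poly F \<zeta>)" if "\<zeta> \<in> frontier ?S" for \<zeta>
        using near[of \<zeta>] front[OF that] F(3)[OF w0(1), of \<zeta>] \<open>d > 0\<close> \<open>D > 0\<close>
        by (simp add: m_def M_def pos_divide_le_eq mult.commute)
    qed (use \<open>m > 0\<close> that in auto)
    then show ?thesis using F(1) by simp
  qed

  \<comment> \<open>The largest factor for which \<open>upper\<close> sends the closed \<open>\<delta>\<close>-neighbourhood of \<open>E\<close>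
    into the disc of radius \<open>\<delta>\<close> around \<open>z0\<close>.\<close>
  define \<kappa> where "\<kappa> = \<delta> * exp (- (real d * s)) / M"
  have \<kappa>: "\<kappa> > 0" using \<open>\<delta> > 0\<close> \<open>M > 0\<close> by (simp add: \<kappa>_def)
  define P where "P = [:z0:] + smult (of_real \<kappa>) F"
  have P: "dist (poly P z) z0 = \<kappa> * norm (poly F z)" for z
    using \<kappa> by (simp add: P_def dist_norm norm_mult)
  have deg: "degree P = d"
    unfolding P_def using F(1) \<open>d > 0\<close> \<kappa> by (subst degree_add_eq_right) auto
  have into_disc: "dist (poly P z) z0 \<le> \<delta>" if "infdist z E \<le> \<delta>" for z
  proof -
    have "dist (poly P z) z0 \<le> \<kappa> * (M * exp (real d * s))"
      unfolding P using upper[OF that] \<kappa> by (intro mult_left_mono) auto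
    also have "\<dots> = \<delta>" using \<open>M > 0\<close> by (simp add: \<kappa>_def exp_minus)
    finally show ?thesis .
  qed
  have "\<delta>^2 / (real d * D) * exp (real d * (g z - 2 * s)) \<le> dist (poly P z) z0"
    if "infdist z E > \<delta>" for z
  proof -
    have "exp (real d * (g z - 2 * s)) = exp (- (real d * s)) * exp (real d * (g z - s))"
      by (simp add: exp_add[symmetric] algebra_simps)
    then have "\<delta>^2 / (real d * D) * exp (real d * (g z - 2 * s)) = \<kappa> * (m * exp (real d * (g z - s)))"
      using \<open>M > 0\<close> by (simp add: \<kappa>_def m_def power2_eq_square)
    also have "\<dots> \<le> \<kappa> * norm (poly F z)" using lower[OF that] \<kappa> by (intro mult_left_mono) auto
    finally show ?thesis by (simp add: P)
  qed
  with deg z0 into_disc show ?thesis by (rule that)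
qed

text \<open>
  By the choice of \<open>\<delta>\<close> below, \<open>E\<close> and the disc of radius \<open>\<delta>\<close> around \<open>z0\<close> together are forward
  invariant, so they lie in the filled-in Julia set. Conversely, outside the \<open>\<delta>\<close>-neighbourhood
  \<open>g (P z) \<ge> d g z - T\<close>, because \<open>g\<close> differs from \<open>ln \<bar>z\<bar>\<close> by a bounded amount near infinity; this
  gives the sublevel bound. In \<open>T\<close> the factor \<open>\<delta>\<^sup>2 / d\<close> contributes \<open>(1 + 2 / \<alpha>) ln d\<close>, and all
  remaining terms are collected in the constant \<open>C\<close>, which depends only on \<open>E\<close> and \<open>A\<close>.
\<close>
lemma polynomials_with_nearby_julia_sets:
  fixes E :: "complex set"
  assumes "compact E" "polynomially_convex E" "regular E" "\<alpha> > 0" and holder: "green_holder E A \<alpha>"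
  obtains C where "\<And>n. n \<ge> 1 \<Longrightarrow> \<exists>P. degree P = n + 1 \<and> E \<subseteq> filled_julia P \<and>
    (\<forall>z\<in>filled_julia P. green E z \<le> ((1 + 2 / \<alpha>) * ln (real n + 1) + C) / real n)"
proof -
  let ?g = "green E"
  have g: "is_green_function E ?g" using assms(3) by (rule is_green_function_green)
  have A: "A > 0" using holder by (simp add: green_holder_def)
  have inf: "infinite E" using assms(2,3) by (rule polynomially_convex_regular_imp_infinite)
  then obtain x0 where x0: "x0 \<in> E" by (metis all_not_in_conv finite.emptyI)
  obtain \<rho> where \<rho>: "\<rho> \<ge> 1" "\<And>x. x \<in> E \<Longrightarrow> norm x \<le> \<rho>"
  proof -
    obtain r where "\<And>x. x \<in> E \<Longrightarrow> norm x \<le> r"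
      using compact_imp_bounded[OF \<open>compact E\<close>] by (auto simp: bounded_iff)
    then show ?thesis by (intro that[of "max 1 r"]) (auto simp: le_max_iff_disj)
  qed
  have diam: "dist x y \<le> 2 * \<rho>" if "x \<in> E" "y \<in> E" for x y
    using norm_triangle_ineq4[of x y] \<rho>(2)[OF that(1)] \<rho>(2)[OF that(2)] by (simp add: dist_norm)
  obtain R b where Rb: "R \<ge> 1" "b \<ge> 0" "\<And>z. R \<le> norm z \<Longrightarrow> ln (norm z) - b \<le> ?g z"
    using green_function_log_lower_bound[OF g] by blast
  define Y where "Y = max R \<rho>"
  have Y: "Y \<ge> 1" "Y \<ge> R" "Y \<ge> \<rho>" using Rb by (auto simp: Y_def)
  have bdd: "\<exists>C. \<forall>z. norm z \<le> B \<longrightarrow> ?g z \<le> C" for B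
  proof -
    have "?g z \<le> A * (\<bar>B\<bar> + \<rho>) powr \<alpha>" if "norm z \<le> B" for z
    proof (rule green_holder_closed[OF holder])
      show "infdist z E \<le> \<bar>B\<bar> + \<rho>"
        using infdist_le[OF x0, of z] norm_triangle_ineq4[of z x0] \<rho>(2)[OF x0] that
        by (simp add: dist_norm)
    qed (use \<rho> in auto)
    then show ?thesis by blast
  qed
  define C where "C = ln (2 * \<rho>) + 2 * A + ln 2 + b + ln Y"
  show ?thesis
  proof (rule that[of C])
    fix n :: nat assume n: "n \<ge> 1"
    define d where "d = n + 1"
    have d: "d > 0" "real d = real n + 1" using n by (auto simp: d_def)
    \<comment> \<open>At this distance from \<open>E\<close> the Hoelder bound gives \<open>g \<le> A / d\<close>, which a polynomial of
      degree \<open>d\<close> turns into a bounded factor \<open>exp A\<close>.\<close>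
    define \<delta> where "\<delta> = real d powr (- 1 / \<alpha>)"
    have \<delta>: "\<delta> > 0" "\<delta> powr \<alpha> = 1 / real d" "ln \<delta> = - ln (real d) / \<alpha>"
    proof -
      show "\<delta> > 0" using d(1) by (simp add: \<delta>_def)
      have "\<delta> powr \<alpha> = real d powr (- 1)"
        unfolding \<delta>_def powr_powr using \<open>\<alpha> > 0\<close> by simp
      then show "\<delta> powr \<alpha> = 1 / real d" using d(1) by (simp add: powr_minus_divide)
      show "ln \<delta> = - ln (real d) / \<alpha>" unfolding \<delta>_def using d(1) by (subst ln_powr) auto
    qed
    have near: "?g z \<le> A / real d" if "infdist z E \<le> \<delta>" for z
      using green_holder_closed[OF holder \<delta>(1) that] \<delta>(2) by simp
    obtain P z0 where deg: "degree P = d" and z0: "z0 \<in> E"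
      and into_disc: "\<And>z. infdist z E \<le> \<delta> \<Longrightarrow> dist (poly P z) z0 \<le> \<delta>"
      and away: "\<And>z. infdist z E > \<delta> \<Longrightarrow>
        \<delta>^2 / (real d * (2 * \<rho>)) * exp (real d * (?g z - 2 * (A / real d))) \<le> dist (poly P z) z0"
    proof (rule contracting_fekete_polynomial[OF \<open>compact E\<close> inf assms(2) g d(1) \<delta>(1)])
      show "2 * \<rho> > 0" using \<rho>(1) by simp
      show "dist x y \<le> 2 * \<rho>" if "x \<in> E" "y \<in> E" for x y using that by (rule diam)
      show "?g z \<le> A / real d" if "infdist z E \<le> \<delta>" for z using that by (rule near)
    qed (rule that)

    have "E \<union> cball z0 \<delta> \<subseteq> filled_julia P"
    proof (rule forward_invariant_subset_filled_julia)
      show "bounded (E \<union> cball z0 \<delta>)" using compact_imp_bounded[OF \<open>compact E\<close>] by simp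
      fix z assume "z \<in> E \<union> cball z0 \<delta>"
      then have "infdist z E \<le> \<delta>"
        using infdist_le[OF z0, of z] \<delta>(1) by (auto simp: dist_commute)
      from into_disc[OF this] show "poly P z \<in> E \<union> cball z0 \<delta>" by (simp add: dist_commute)
    qed
    then have E_sub: "E \<subseteq> filled_julia P" by blast

    define c where "c = (1 + 2 / \<alpha>) * ln (real d) + ln (2 * \<rho>) + 2 * A"
    define T where "T = (1 + 2 / \<alpha>) * ln (real d) + C"
    have T: "T = c + ln 2 + b + ln Y" by (simp add: T_def c_def C_def)
    have "c \<ge> 2 * A" using d \<open>\<alpha> > 0\<close> \<rho>(1) by (simp add: c_def)
    have "ln 2 > (0::real)" "ln Y \<ge> 0" using Y(1) by auto
    then have "T \<ge> A" using \<open>c \<ge> 2 * A\<close> A Rb(2) unfolding T by linarith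
    have far: "exp (real d * ?g z - c) \<le> dist (poly P z) z0" if "infdist z E > \<delta>" for z
    proof -
      let ?q = "\<delta>^2 / (real d * (2 * \<rho>))"
      have "?q > 0" using \<delta>(1) d(1) \<rho>(1) by simp
      have "ln ?q = 2 * ln \<delta> - ln (real d) - ln (2 * \<rho>)"
        using \<delta>(1) d(1) \<rho>(1) by (simp add: ln_div ln_mult ln_realpow)
      also have "\<dots> = 2 * A - c" by (simp add: c_def \<delta>(3) algebra_simps)
      finally have "?q = exp (2 * A - c)" using \<open>?q > 0\<close> by (metis exp_ln)
      moreover have "real d * (?g z - 2 * (A / real d)) = real d * ?g z - 2 * A"
        using d(1) by (simp add: right_diff_distrib)
      ultimately show ?thesis using away[OF that] by (simp add: exp_add[symmetric])
    qed
    have "?g z \<le> T / real n" if z: "z \<in> filled_julia P" for z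
    \<comment> \<open>The threshold \<open>T / n\<close> is the fixed point of \<open>x \<mapsto> d x - T\<close>.\<close>
    proof (rule filled_julia_sublevel[where q = "real d", OF _ bdd _ z])
      show "real d > 1" using n by (simp add: d_def)
      fix z assume gz: "?g z > T / real n"
      have nT: "real n * (T / real n) = T" using n by simp
      have "?g z > A / real d"
      proof -
        have "A / real d \<le> A / real n" using A n d by (intro divide_left_mono) auto
        also have "\<dots> \<le> T / real n" using \<open>T \<ge> A\<close> by (intro divide_right_mono) auto
        finally show ?thesis using gz by simp
      qed
      then have dist: "infdist z E > \<delta>" using near[of z] by force
      have "A / real d > 0" using A d(1) by simp
      then have "?g z > 0" using \<open>?g z > A / real d\<close> by linarith
      let ?X = "exp (real d * ?g z - c)"
      have "real n * ?g z > T" using gz n by (simp add: pos_divide_less_eq mult.commute)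
      then have "real d * ?g z - c \<ge> ln (2 * Y)"
        using \<open>?g z > 0\<close> T Rb(2) Y(1) by (simp add: d ln_mult algebra_simps)
      then have "exp (ln (2 * Y)) \<le> ?X" by simp
      then have X: "?X \<ge> 2 * Y" using Y(1) by simp
      \<comment> \<open>Since \<open>\<bar>z0\<bar> \<le> Y\<close>, at least half of the distance to \<open>z0\<close> survives in the modulus.\<close>
      have "norm (poly P z) \<ge> ?X / 2"
        using far[OF dist] norm_triangle_ineq4[of "poly P z" z0] \<rho>(2)[OF z0] Y X
        by (simp add: dist_norm)
      then have "norm (poly P z) \<ge> R" "ln (norm (poly P z)) \<ge> ln (?X / 2)"
        using X Y by (linarith, intro ln_mono) auto
      then have "?g (poly P z) \<ge> real d * ?g z - c - ln 2 - b"
        using Rb(3)[of "poly P z"] by (simp add: ln_div)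
      then have "?g (poly P z) \<ge> real d * ?g z - T"
        using T Y(1) by (smt (verit) ln_ge_zero)
      then show "real d * (?g z - T / real n) \<le> ?g (poly P z) - T / real n"
        unfolding d(2) distrib_right right_diff_distrib nT by simp
    qed
    then have "\<forall>z\<in>filled_julia P. ?g z \<le> ((1 + 2 / \<alpha>) * ln (real n + 1) + C) / real n"
      unfolding T_def d(2) by blast
    with deg E_sub show "\<exists>P. degree P = n + 1 \<and> E \<subseteq> filled_julia P \<and>
        (\<forall>z\<in>filled_julia P. ?g z \<le> ((1 + 2 / \<alpha>) * ln (real n + 1) + C) / real n)"
      unfolding d_def by blast
  qed
qed

text \<open>
  Since \<open>E\<close> lies in the filled-in Julia set, the Green function of the latter vanishes on \<open>E\<close>, and
  only the other half of the distance matters.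
\<close>
lemma klimek_dist_le:
  assumes "is_green_function E (green E)" "E \<noteq> {}" "polynomially_convex E"
    and "degree P \<ge> 2" "E \<subseteq> filled_julia P"
    and bound: "\<And>z. z \<in> filled_julia P \<Longrightarrow> green E z \<le> c"
  shows "klimek_dist E (filled_julia P) \<le> c"
proof -
  have ne: "filled_julia P \<noteq> {}" using assms by auto
  obtain g where "is_green_function (filled_julia P) g" "\<And>z. z \<in> filled_julia P \<Longrightarrow> g z = 0"
    using filled_julia_has_green_function[OF assms(4) ne] by blast
  then have "green (filled_julia P) z = 0" if "z \<in> E" for z
    using that assms(5) green_eqI by blast
  then have "(SUP z\<in>E. green (filled_julia P) z) = 0" using \<open>E \<noteq> {}\<close> by simp
  moreover obtain x where "x \<in> E" using \<open>E \<noteq> {}\<close> by blast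
  then have "green E x = 0"
    using assms(1,3) by (simp add: is_green_function_def polynomially_convex_def)
  then have "0 \<le> c" using bound[of x] \<open>x \<in> E\<close> assms(5) by auto
  moreover have "(SUP z\<in>filled_julia P. green E z) \<le> c"
    using ne bound by (rule cSUP_least)
  ultimately show ?thesis by (simp add: klimek_dist_def)
qed

lemma log_rate_eventually_le:
  fixes C K :: real
  assumes "\<alpha> < 1 / 2"
  shows "eventually (\<lambda>n. (K * ln (real n + 1) + C) / real n \<le> real n powr (- 2 * \<alpha>)) sequentially"
proof -
  define \<beta> where "\<beta> = 1 - 2 * \<alpha>"
  have "\<beta> > 0" using assms by (simp add: \<beta>_def)
  have "(\<lambda>n. (K * ln (real n + 1) + C) / real n powr \<beta>) \<longlonglongrightarrow> 0"
    using \<open>\<beta> > 0\<close> by real_asymp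
  then have "eventually (\<lambda>n. (K * ln (real n + 1) + C) / real n powr \<beta> < 1) sequentially"
    by (rule order_tendstoD) simp
  then show ?thesis
    using eventually_gt_at_top[of 0]
  proof eventually_elim
    case (elim n)
    have "(K * ln (real n + 1) + C) / real n = ((K * ln (real n + 1) + C) / real n powr \<beta>) * real n powr (- 2 * \<alpha>)"
    proof -
      have "real n powr \<beta> = real n * real n powr (- 2 * \<alpha>)"
        using elim by (simp add: \<beta>_def powr_mult_base)
      then show ?thesis using elim by simp
    qed
    also have "\<dots> \<le> 1 * real n powr (- 2 * \<alpha>)"
      using elim by (intro mult_right_mono) auto
    finally show ?case by simp
  qed
qed

theorem corollary5p1:
  fixes E :: "complex set" and A \<alpha> :: real
  assumes "compact E" and "polynomially_convex E" and "regular E"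
    and "0 < \<alpha>" and "\<alpha> \<le> 1"
    and "green_holder E A \<alpha>"
  shows "\<exists>N::nat. \<forall>n\<ge>N. \<exists>P :: complex poly. degree P = n + 1 \<and>
    (1/2 \<le> \<alpha> \<and> \<alpha> \<le> 1 \<longrightarrow>
       klimek_dist E (filled_julia P) \<le> (3 * A + 12) * (1 / real n) * ln (real n + 1)) \<and>
    (0 < \<alpha> \<and> \<alpha> < 1/2 \<longrightarrow>
       klimek_dist E (filled_julia P) \<le> (3 * A + 12) * real n powr (- 2 * \<alpha>))"
proof -
  obtain C where C: "\<And>n. n \<ge> 1 \<Longrightarrow> \<exists>P. degree P = n + 1 \<and> E \<subseteq> filled_julia P \<and>
    (\<forall>z\<in>filled_julia P. green E z \<le> ((1 + 2 / \<alpha>) * ln (real n + 1) + C) / real n)"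
    using polynomials_with_nearby_julia_sets[OF assms(1-4,6)] by blast
  have g: "is_green_function E (green E)" using assms(3) by (rule is_green_function_green)
  have "E \<noteq> {}" using polynomially_convex_regular_imp_infinite[OF assms(2,3)] by auto
  have A: "A > 0" using assms(6) by (simp add: green_holder_def)
  let ?L = "\<lambda>n::nat. ln (real n + 1)"
  have large: "eventually (\<lambda>n. C \<le> 7 * ?L n) sequentially"
    by real_asymp
  have small: "eventually (\<lambda>n. \<alpha> < 1 / 2 \<longrightarrow>
      ((1 + 2 / \<alpha>) * ?L n + C) / real n \<le> real n powr (- 2 * \<alpha>)) sequentially"
    using log_rate_eventually_le by (cases "\<alpha> < 1 / 2") auto
  have "eventually (\<lambda>n. \<exists>P :: complex poly. degree P = n + 1 \<and>
    (1/2 \<le> \<alpha> \<and> \<alpha> \<le> 1 \<longrightarrow>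
       klimek_dist E (filled_julia P) \<le> (3 * A + 12) * (1 / real n) * ln (real n + 1)) \<and>
    (0 < \<alpha> \<and> \<alpha> < 1/2 \<longrightarrow>
       klimek_dist E (filled_julia P) \<le> (3 * A + 12) * real n powr (- 2 * \<alpha>))) sequentially"
    using large small eventually_ge_at_top[of 1]
  proof eventually_elim
    case (elim n)
    obtain P where P: "degree P = n + 1" "E \<subseteq> filled_julia P"
      "\<And>z. z \<in> filled_julia P \<Longrightarrow> green E z \<le> ((1 + 2 / \<alpha>) * ?L n + C) / real n"
      using C[OF elim(3)] by blast
    have dist: "klimek_dist E (filled_julia P) \<le> ((1 + 2 / \<alpha>) * ?L n + C) / real n"
      using elim(3) P by (intro klimek_dist_le[OF g \<open>E \<noteq> {}\<close> assms(2)]) auto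
    have "((1 + 2 / \<alpha>) * ?L n + C) / real n \<le> (3 * A + 12) * (1 / real n) * ?L n" if "1 / 2 \<le> \<alpha>"
    proof -
      have "2 / \<alpha> \<le> 2 / (1 / 2)" using that by (intro divide_left_mono) auto
      then have "(1 + 2 / \<alpha>) * ?L n \<le> 5 * ?L n" by (intro mult_right_mono) auto
      moreover have "0 \<le> 3 * A * ?L n" using A by simp
      ultimately have "(1 + 2 / \<alpha>) * ?L n + C \<le> (3 * A + 12) * ?L n"
        using elim(1) by (simp add: distrib_right)
      then have "((1 + 2 / \<alpha>) * ?L n + C) / real n \<le> (3 * A + 12) * ?L n / real n"
        by (rule divide_right_mono) simp
      then show ?thesis by simp
    qed
    moreover have "((1 + 2 / \<alpha>) * ?L n + C) / real n \<le> (3 * A + 12) * real n powr (- 2 * \<alpha>)" if "\<alpha> < 1 / 2"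
    proof -
      have "1 * real n powr (- 2 * \<alpha>) \<le> (3 * A + 12) * real n powr (- 2 * \<alpha>)"
        using A by (intro mult_right_mono) auto
      then show ?thesis using elim(2) that by simp
    qed
    ultimately show ?case using P(1) order_trans[OF dist] by (intro exI[of _ P]) blast
  qed
  then show ?thesis by (simp add: eventually_sequentially)
qed

end
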